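(* Let $(A,\tau_A)$ be a unital locally $C^{\ast}$-algebra, and let $I$ and $J$ be closed $^{\ast}$-ideals in $A$, each equipped with the topology induced by $\tau_A$ (i.e. $\tau_I=\tau_A|_I$, $\tau_J=\tau_A|_J$). Then $$(I+J)^{+}=I^{+}+J^{+},$$ where $I^{+}+J^{+}=\{a+b: a\in I^{+},\ b\in J^{+}\}$.
   Context: A locally $C^{\ast}$-algebra is a complete Hausdorff topological $^{\ast}$-algebra over $\mathbb{C}$ whose topology is generated by a separating (saturated) family of $C^{\ast}$-seminorms $\|\cdot\|_\alpha$ (seminorms with $\|a^*a\|_\alpha=\|a\|_\alpha^2$); equivalently, it is topologically $^{\ast}$-isomorphic to a projective limit of a projective family of $C^{\ast}$-algebras. A $^{\ast}$-ideal is a two-sided ideal closed under the involution. An element $a$ of a unital locally $C^{\ast}$-algebra $A$ is positive if $a=a^*$ and its spectrum $\{z\in\mathbb{C}: z e_A-a \text{ not invertible in } A\}$ is contained in $[0,\infty)$; equivalently $a=b^*b$ for some $b\in A$. $A^{+}$ denotes the set of positive elements of $A$, and for a subset $S\subseteq A$ (such as $I$, $J$ or $I+J$), $S^{+}$ denotes the set of elements of $S$ that are positive, i.e. $S^{+}=S\cap A^{+}$. *)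

theory Defs
  imports Complex_Main
begin

text \<open>A unital complex *-algebra is modelled on a type 'a of class ring_1 together with
  an explicit complex scalar multiplication smul and an involution star.
  The locally C*-topology is given by a family of seminorms p indexed by a type 'i.\<close>

definition complex_algebra :: "(complex \<Rightarrow> 'a::ring_1 \<Rightarrow> 'a) \<Rightarrow> bool" where
  "complex_algebra smul \<longleftrightarrow>
     (\<forall>x. smul 1 x = x) \<and>
     (\<forall>a b x. smul (a * b) x = smul a (smul b x)) \<and>
     (\<forall>a b x. smul (a + b) x = smul a x + smul b x) \<and>
     (\<forall>a x y. smul a (x + y) = smul a x + smul a y) \<and>
     (\<forall>a x y. smul a (x * y) = smul a x * y) \<and>
     (\<forall>a x y. smul a (x * y) = x * smul a y)"

definition involution :: "(complex \<Rightarrow> 'a::ring_1 \<Rightarrow> 'a) \<Rightarrow> ('a \<Rightarrow> 'a) \<Rightarrow> bool" where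
  "involution smul star \<longleftrightarrow>
     (\<forall>x y. star (x + y) = star x + star y) \<and>
     (\<forall>c x. star (smul c x) = smul (cnj c) (star x)) \<and>
     (\<forall>x y. star (x * y) = star y * star x) \<and>
     (\<forall>x. star (star x) = x)"

definition C_star_seminorm ::
  "(complex \<Rightarrow> 'a::ring_1 \<Rightarrow> 'a) \<Rightarrow> ('a \<Rightarrow> 'a) \<Rightarrow> ('a \<Rightarrow> real) \<Rightarrow> bool" where
  "C_star_seminorm smul star q \<longleftrightarrow>
     (\<forall>x. 0 \<le> q x) \<and>
     (\<forall>x y. q (x + y) \<le> q x + q y) \<and>
     (\<forall>c x. q (smul c x) = cmod c * q x) \<and>
     (\<forall>x y. q (x * y) \<le> q x * q y) \<and>
     (\<forall>x. q (star x * x) = (q x)\<^sup>2)"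

definition sn_converges :: "('i \<Rightarrow> 'a::ring_1 \<Rightarrow> real) \<Rightarrow> 'a filter \<Rightarrow> 'a \<Rightarrow> bool" where
  "sn_converges p F x \<longleftrightarrow> (\<forall>i e. e > 0 \<longrightarrow> eventually (\<lambda>y. p i (y - x) < e) F)"

definition sn_cauchy :: "('i \<Rightarrow> 'a::ring_1 \<Rightarrow> real) \<Rightarrow> 'a filter \<Rightarrow> bool" where
  "sn_cauchy p F \<longleftrightarrow> (\<forall>i e. e > 0 \<longrightarrow> eventually (\<lambda>(x, y). p i (x - y) < e) (F \<times>\<^sub>F F))"

definition locally_C_star_algebra ::
  "(complex \<Rightarrow> 'a::ring_1 \<Rightarrow> 'a) \<Rightarrow> ('a \<Rightarrow> 'a) \<Rightarrow> ('i \<Rightarrow> 'a \<Rightarrow> real) \<Rightarrow> bool" where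
  "locally_C_star_algebra smul star p \<longleftrightarrow>
     complex_algebra smul \<and> involution smul star \<and>
     (\<forall>i. C_star_seminorm smul star (p i)) \<and>
     \<comment> \<open>saturated (upward directed) family\<close>
     (\<forall>i j. \<exists>k. \<forall>x. p i x \<le> p k x \<and> p j x \<le> p k x) \<and>
     \<comment> \<open>separating (Hausdorff)\<close>
     (\<forall>x. (\<forall>i. p i x = 0) \<longrightarrow> x = 0) \<and>
     \<comment> \<open>complete: every proper Cauchy filter converges\<close>
     (\<forall>F. F \<noteq> bot \<longrightarrow> sn_cauchy p F \<longrightarrow> (\<exists>x. sn_converges p F x))"

definition sn_closed :: "('i \<Rightarrow> 'a::ring_1 \<Rightarrow> real) \<Rightarrow> 'a set \<Rightarrow> bool" where
  "sn_closed p S \<longleftrightarrow> (\<forall>x. (\<forall>i e. e > 0 \<longrightarrow> (\<exists>y\<in>S. p i (x - y) < e)) \<longrightarrow> x \<in> S)"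

definition star_ideal ::
  "(complex \<Rightarrow> 'a::ring_1 \<Rightarrow> 'a) \<Rightarrow> ('a \<Rightarrow> 'a) \<Rightarrow> 'a set \<Rightarrow> bool" where
  "star_ideal smul star I \<longleftrightarrow>
     0 \<in> I \<and> (\<forall>x\<in>I. \<forall>y\<in>I. x + y \<in> I) \<and>
     (\<forall>c. \<forall>x\<in>I. smul c x \<in> I) \<and>
     (\<forall>x\<in>I. \<forall>a. a * x \<in> I \<and> x * a \<in> I) \<and>
     (\<forall>x\<in>I. star x \<in> I)"

definition invertible_el :: "'a::ring_1 \<Rightarrow> bool" where
  "invertible_el x \<longleftrightarrow> (\<exists>y. x * y = 1 \<and> y * x = 1)"

definition alg_spectrum :: "(complex \<Rightarrow> 'a::ring_1 \<Rightarrow> 'a) \<Rightarrow> 'a \<Rightarrow> complex set" where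
  "alg_spectrum smul a = {z. \<not> invertible_el (smul z 1 - a)}"

definition positive_el ::
  "(complex \<Rightarrow> 'a::ring_1 \<Rightarrow> 'a) \<Rightarrow> ('a \<Rightarrow> 'a) \<Rightarrow> 'a \<Rightarrow> bool" where
  "positive_el smul star a \<longleftrightarrow>
     star a = a \<and> alg_spectrum smul a \<subseteq> {z. Im z = 0 \<and> Re z \<ge> 0}"

end

theory Submission
  imports Defs
begin

text \<open>
  For a C*-seminorm \<open>q\<close>, a self-adjoint \<open>h\<close> is called positive if \<open>q (t - h) \<le> t\<close> for some
  \<open>t \<ge> 0\<close>. Such \<open>h\<close> form a closed convex cone. Approximate square roots and the unitary
  trick \<open>(r + \<i> c)\<^sup>* (r + \<i> c) = r\<^sup>2 + c\<^sup>2\<close> give monotonicity of \<open>q\<close> without any spectral theory.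
  An element of a locally C*-algebra is positive in the spectral sense iff it is so for every
  seminorm, so sums of positive elements are positive.

  Conversely let \<open>x = a + b \<ge> 0\<close> with \<open>a \<in> I\<close>, \<open>b \<in> J\<close> self-adjoint. Then \<open>x \<le> y\<close> for
  \<open>y = \<bar>a\<bar> + \<bar>b\<bar>\<close>, and \<open>u\<^sub>n = \<surd>x (y + 1/n)\<^sup>-\<^sup>1\<^sup>/\<^sup>2 \<surd>\<bar>a\<bar>\<close> and \<open>v\<^sub>n = \<surd>x (y + 1/n)\<^sup>-\<^sup>1\<^sup>/\<^sup>2 \<surd>\<bar>b\<bar>\<close> converge to
  some \<open>u \<in> I\<close> and \<open>v \<in> J\<close> with \<open>u u\<^sup>* + v v\<^sup>* = lim \<surd>x y (y + 1/n)\<^sup>-\<^sup>1 \<surd>x = x\<close>.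
\<close>

subsection \<open>Positivity with respect to a C*-seminorm\<close>

locale star_algebra =
  fixes smul :: "complex \<Rightarrow> 'a::ring_1 \<Rightarrow> 'a" (infixr "*\<^sub>C" 75)
    and star :: "'a \<Rightarrow> 'a"
  assumes complex_algebra: "complex_algebra smul"
    and involution: "involution smul star"
begin

sublocale vs: vector_space smul
  using complex_algebra by unfold_locales (auto simp: complex_algebra_def)

lemma smul_mult_left: "c *\<^sub>C x * y = c *\<^sub>C (x * y)"
  and mult_smul_right: "x * c *\<^sub>C y = c *\<^sub>C (x * y)"
  using complex_algebra unfolding complex_algebra_def by metis+

lemma star_add: "star (x + y) = star x + star y"
  and star_smul: "star (c *\<^sub>C x) = cnj c *\<^sub>C star x"
  and star_mult: "star (x * y) = star y * star x"
  and star_star: "star (star x) = x"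
  using involution unfolding involution_def by auto

lemma star_zero: "star 0 = 0"
  using star_smul[of 0 0] by simp

lemma star_minus: "star (- x) = - star x"
  using star_add[of x "- x"] by (simp add: star_zero eq_neg_iff_add_eq_0 add.commute)

lemma star_diff: "star (x - y) = star x - star y"
  using star_add[of x "- y"] by (simp add: star_minus)

lemma star_one: "star 1 = 1"
  by (metis mult.right_neutral star_mult star_star)

lemmas star_simps = star_add star_smul star_mult star_star star_zero star_minus star_diff star_one

definition emb :: "real \<Rightarrow> 'a" where
  "emb t = complex_of_real t *\<^sub>C 1"

lemma star_emb: "star (emb t) = emb t"
  by (simp add: emb_def star_simps)

lemma emb_commute: "z * emb t = emb t * z"
  by (simp add: emb_def smul_mult_left mult_smul_right)

lemma emb_left_commute: "z * (emb t * w) = emb t * (z * w)"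
  by (simp add: emb_def smul_mult_left mult_smul_right)

lemma emb_add: "emb (s + t) = emb s + emb t"
  and emb_diff: "emb (s - t) = emb s - emb t"
  and emb_1: "emb 1 = 1"
  by (simp_all add: emb_def vs.scale_left_distrib vs.scale_left_diff_distrib smul_mult_left)

text \<open>With limit \<open>Y\<close>, \<open>1 - Y\<close> is a square root of \<open>1 - w\<close>, since
  \<open>(1 - Y)\<^sup>2 = 1 - w\<close> amounts to \<open>Y = (w + Y\<^sup>2) / 2\<close>.\<close>

primrec sqrt_iter :: "'a \<Rightarrow> nat \<Rightarrow> 'a" where
  "sqrt_iter w 0 = 0"
| "sqrt_iter w (Suc n) = (1/2) *\<^sub>C (w + sqrt_iter w n * sqrt_iter w n)"

lemma star_sqrt_iter: "star w = w \<Longrightarrow> star (sqrt_iter w n) = sqrt_iter w n"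
  by (induction n) (simp_all add: star_simps)

lemma sqrt_iter_commute:
  assumes "z * w = w * z" shows "z * sqrt_iter w n = sqrt_iter w n * z"
proof (induction n)
  case (Suc n)
  have "z * (sqrt_iter w n * sqrt_iter w n) = sqrt_iter w n * sqrt_iter w n * z"
    by (metis Suc mult.assoc)
  then show ?case
    by (simp add: assms smul_mult_left mult_smul_right distrib_left distrib_right)
qed simp

lemma two_half: "(1/2) *\<^sub>C x + (1/2) *\<^sub>C x = x"
  by (simp flip: vs.scale_left_distrib)

text \<open>Turns bounds on the increments of the iteration into error bounds for the approximate
  square root \<open>1 - sqrt_iter w n\<close>.\<close>

lemma sqrt_iter_square:
  "(1 - sqrt_iter w n) * (1 - sqrt_iter w n) - (1 - w)
    = 2 * (sqrt_iter w (Suc n) - sqrt_iter w n)"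
  using two_half[of "w + sqrt_iter w n * sqrt_iter w n"]
  by (simp add: algebra_simps mult_2)

end

text \<open>The scalar iteration at \<open>w = 1\<close>. It majorises both the size and the
  increments of \<open>sqrt_iter w\<close> under every C*-seminorm with
  \<open>q w \<le> 1\<close>.\<close>

primrec sqrt_bound :: "nat \<Rightarrow> real" where
  "sqrt_bound 0 = 0"
| "sqrt_bound (Suc n) = (1 + sqrt_bound n * sqrt_bound n) / 2"

lemma sqrt_bound_bounds: "0 \<le> sqrt_bound n \<and> sqrt_bound n \<le> 1"
  by (induction n) (auto simp: mult_le_one)

lemma sqrt_bound_mono: "mono sqrt_bound"
proof (rule incseq_SucI)
  show "sqrt_bound n \<le> sqrt_bound (Suc n)" for n
    using sum_squares_ge_zero[of "sqrt_bound n - 1" 0] by (simp add: algebra_simps)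
qed

lemma sqrt_bound_convergent: "convergent sqrt_bound"
  using sqrt_bound_mono sqrt_bound_bounds
  by (intro Bseq_monoseq_convergent BseqI'[of _ 1]) (auto simp: monoseq_def mono_def)

lemma sqrt_bound_step: "(\<lambda>n. sqrt_bound (Suc n) - sqrt_bound n) \<longlonglongrightarrow> 0"
proof -
  obtain l where l: "sqrt_bound \<longlonglongrightarrow> l"
    using sqrt_bound_convergent by (auto simp: convergent_def)
  show ?thesis
    using tendsto_diff[OF LIMSEQ_Suc[OF l] l] by (simp only: diff_self)
qed

locale C_star_seminorm_algebra = star_algebra +
  fixes q :: "'a::ring_1 \<Rightarrow> real"
  assumes C_star_seminorm: "C_star_seminorm smul star q"
begin

section \<open>Elementary rules for a C*-seminorm\<close>

lemma q_nonneg: "0 \<le> q x"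
  and q_add: "q (x + y) \<le> q x + q y"
  and q_smul: "q (c *\<^sub>C x) = cmod c * q x"
  and q_mult: "q (x * y) \<le> q x * q y"
  and q_C_star: "q (star x * x) = (q x)\<^sup>2"
  using C_star_seminorm unfolding C_star_seminorm_def by auto

lemma q_zero: "q 0 = 0"
  using q_smul[of 0 0] by simp

lemma q_minus: "q (- x) = q x"
  using q_smul[of "-1" x] by simp

lemma q_diff: "q (x - y) \<le> q x + q y"
  using q_add[of x "- y"] by (simp add: q_minus)

lemma q_minus_commute: "q (x - y) = q (y - x)"
  using q_minus[of "x - y"] by simp

lemma q_star: "q (star x) = q x"
proof -
  have "q x \<le> q (star x)" for x
  proof -
    have "q x * q x \<le> q (star x) * q x"
      using q_C_star[of x] q_mult[of "star x" x] by (simp add: power2_eq_square)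
    then show ?thesis
      using q_nonneg[of x] q_nonneg[of "star x"] by (cases "q x = 0") auto
  qed
  from this[of x] this[of "star x"] show ?thesis by (simp add: star_star)
qed

lemma q_C_star': "q (x * star x) = (q x)\<^sup>2"
  using q_C_star[of "star x"] by (simp add: star_star q_star)

lemma q_square: "star x = x \<Longrightarrow> q (x * x) = (q x)\<^sup>2"
  using q_C_star[of x] by simp

text \<open>The C*-identity makes \<open>q 1\<close> idempotent, hence 0 or 1; the value 0 occurs
  when \<open>q\<close> vanishes identically.\<close>

lemma q_one: "q 1 \<le> 1"
proof -
  have "q 1 * q 1 = q 1 * 1"
    using q_square[of 1] by (simp add: star_one power2_eq_square)
  then show ?thesis by (metis mult_cancel_left order.refl zero_le_one)
qed

lemma q_emb: "q (emb t) \<le> \<bar>t\<bar>"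
  using q_one q_nonneg[of 1] by (simp add: emb_def q_smul mult_left_le)

lemma q_mult_bound: "q x \<le> a \<Longrightarrow> q y \<le> b \<Longrightarrow> q (x * y) \<le> a * b"
  by (rule order_trans[OF q_mult]) (meson mult_mono order_trans q_nonneg)

lemma q_two: "q (2 * x) = 2 * q x"
proof -
  have "2 * x = 2 *\<^sub>C x"
    by (metis mult_2 one_add_one vs.scale_left_distrib vs.scale_one)
  then show ?thesis by (simp add: q_smul)
qed

lemma q_triangle: "q (x - z) \<le> q (x - y) + q (y - z)"
  using q_add[of "x - y" "y - z"] by simp

section \<open>Convergence rate of the square root iteration\<close>

lemma sqrt_iter_bound:
  assumes "q w \<le> 1"
  shows "q (sqrt_iter w n) \<le> sqrt_bound n"
proof (induction n)
  case (Suc n)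
  have "q (w + sqrt_iter w n * sqrt_iter w n) \<le> 1 + sqrt_bound n * sqrt_bound n"
    using q_add[of w "sqrt_iter w n * sqrt_iter w n"] q_mult_bound[OF Suc Suc] assms by linarith
  then show ?case by (simp add: q_smul)
qed (simp add: q_zero)

text \<open>Successive iterates commute, so the difference of their squares factors, and the bounds
  for the two factors multiply to the same expression in \<open>sqrt_bound\<close>.\<close>

lemma sqrt_iter_step:
  assumes "q w \<le> 1"
  shows "q (sqrt_iter w (Suc n) - sqrt_iter w n) \<le> sqrt_bound (Suc n) - sqrt_bound n"
proof (induction n)
  case 0
  then show ?case using assms by (simp add: q_smul)
next
  case (Suc n)
  let ?a = "sqrt_iter w (Suc n)" and ?b = "sqrt_iter w n"
  let ?s = "sqrt_bound (Suc n)" and ?t = "sqrt_bound n"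
  have "?a * ?b = ?b * ?a"
    by (metis sqrt_iter_commute)
  then have "(?a - ?b) * (?a + ?b) = ?a * ?a - ?b * ?b"
    by (simp add: algebra_simps del: sqrt_iter.simps)
  then have "sqrt_iter w (Suc (Suc n)) - ?a = (1/2) *\<^sub>C ((?a - ?b) * (?a + ?b))"
    by (subst (1 2) sqrt_iter.simps(2))
      (simp add: vs.scale_right_diff_distrib[symmetric] del: sqrt_iter.simps)
  moreover have "q ((?a - ?b) * (?a + ?b)) \<le> (?s - ?t) * (?s + ?t)"
    using q_add[of ?a ?b] sqrt_iter_bound[OF assms, of n] sqrt_iter_bound[OF assms, of "Suc n"]
    by (intro q_mult_bound Suc) linarith
  moreover have "(?s - ?t) * (?s + ?t) / 2 = sqrt_bound (Suc (Suc n)) - ?s"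
    by (simp add: field_simps)
  ultimately show ?case by (simp add: q_smul del: sqrt_iter.simps sqrt_bound.simps)
qed

lemma sqrt_iter_diff:
  assumes "q w \<le> 1"
  shows "q (sqrt_iter w m - sqrt_iter w n) \<le> \<bar>sqrt_bound m - sqrt_bound n\<bar>"
proof -
  have *: "q (sqrt_iter w (n + k) - sqrt_iter w n) \<le> sqrt_bound (n + k) - sqrt_bound n" for n k
  proof (induction k)
    case (Suc k)
    then show ?case
      using q_triangle[of "sqrt_iter w (n + Suc k)" "sqrt_iter w n" "sqrt_iter w (n + k)"]
        sqrt_iter_step[OF assms, of "n + k"]
      by (simp del: sqrt_iter.simps sqrt_bound.simps)
  qed (simp add: q_zero)
  show ?thesis
  proof (cases "n \<le> m")
    case True
    then show ?thesis using *[of n "m - n"] by simp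
  next
    case False
    then show ?thesis using *[of m "n - m"] by (simp add: q_minus_commute)
  qed
qed

text \<open>In a C*-algebra this says that the spectrum of the self-adjoint \<open>h\<close> lies in
  \<open>[0, 2 t]\<close>. The norm form makes sense for a seminorm and needs neither completeness
  nor spectra.\<close>

definition qpos :: "'a \<Rightarrow> bool" where
  "qpos h \<longleftrightarrow> star h = h \<and> (\<exists>t\<ge>0. q (emb t - h) \<le> t)"

lemma qpos_star: "qpos h \<Longrightarrow> star h = h"
  by (simp add: qpos_def)

lemma qpos_add:
  assumes "qpos a" "qpos b" shows "qpos (a + b)"
proof -
  obtain s t where "s \<ge> 0" "t \<ge> 0" "q (emb s - a) \<le> s" "q (emb t - b) \<le> t"
    using assms unfolding qpos_def by auto
  moreover have eq: "emb (s + t) - (a + b) = (emb s - a) + (emb t - b)"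
    by (simp add: emb_add)
  ultimately have "q (emb (s + t) - (a + b)) \<le> s + t"
    unfolding eq using q_add[of "emb s - a" "emb t - b"] by simp
  then show ?thesis
    using assms \<open>s \<ge> 0\<close> \<open>t \<ge> 0\<close> unfolding qpos_def by (metis add_nonneg_nonneg star_add)
qed

lemma qpos_scale:
  assumes "qpos a" "0 \<le> r" shows "qpos (complex_of_real r *\<^sub>C a)"
proof -
  obtain t where t: "t \<ge> 0" "q (emb t - a) \<le> t"
    using assms unfolding qpos_def by auto
  have "emb (r * t) - complex_of_real r *\<^sub>C a = complex_of_real r *\<^sub>C (emb t - a)"
    by (simp add: emb_def vs.scale_right_diff_distrib)
  then have "q (emb (r * t) - complex_of_real r *\<^sub>C a) \<le> r * t"
    using t assms by (simp add: q_smul mult_left_mono)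
  then show ?thesis
    using assms t unfolding qpos_def
    by (metis complex_cnj_complex_of_real mult_nonneg_nonneg star_smul)
qed

lemma qpos_emb: "0 \<le> t \<Longrightarrow> qpos (emb t)"
  unfolding qpos_def by (auto simp: star_emb q_zero intro!: exI[of _ t])

lemma qpos_one: "qpos 1"
  using qpos_emb[of 1] by (simp add: emb_1)

text \<open>No completeness is assumed here, so the iteration is stopped at a finite stage. The
  result is a polynomial in \<open>h\<close> and so commutes with whatever commutes with
  \<open>h\<close>.\<close>

lemma approx_sqrt:
  assumes "qpos h" "e > 0"
  obtains c where "star c = c" "\<And>z. z * h = h * z \<Longrightarrow> z * c = c * z" "q (c * c - h) < e"
proof -
  obtain t where t: "t > 0" "q (emb t - h) \<le> t"
  proof -
    obtain t where "t \<ge> 0" "q (emb t - h) \<le> t"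
      using assms unfolding qpos_def by auto
    \<comment> \<open>Raising \<open>t\<close> by 1 makes it positive, so that \<open>h\<close> can
      be divided by it.\<close>
    moreover have eq: "emb (t + 1) - h = (emb t - h) + 1"
      by (simp add: emb_add emb_1)
    ultimately have "t + 1 > 0" "q (emb (t + 1) - h) \<le> t + 1"
      unfolding eq using q_add[of "emb t - h" 1] q_one by auto
    then show thesis by (rule that)
  qed
  define k where "k = complex_of_real (1 / t) *\<^sub>C h"
  have h: "h = complex_of_real t *\<^sub>C k"
    using t by (simp add: k_def)
  have "emb t - h = complex_of_real t *\<^sub>C (1 - k)"
    by (simp add: h emb_def vs.scale_right_diff_distrib)
  then have k: "q (1 - k) \<le> 1"
    using t by (simp add: q_smul)
  \<comment> \<open>The 2 comes from \<open>sqrt_iter_square\<close>, the \<open>t\<close> from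
    undoing the scaling.\<close>
  have "eventually (\<lambda>n. sqrt_bound (Suc n) - sqrt_bound n < e / (2 * t)) sequentially"
    using assms t by (intro order_tendstoD(2)[OF sqrt_bound_step]) auto
  then obtain n where n: "sqrt_bound (Suc n) - sqrt_bound n < e / (2 * t)"
    by (auto simp: eventually_sequentially)
  define b where "b = 1 - sqrt_iter (1 - k) n"
  have sk: "star k = k"
    using qpos_star[OF assms(1)] by (simp add: k_def star_simps)
  have "b * b - k = 2 * (sqrt_iter (1 - k) (Suc n) - sqrt_iter (1 - k) n)"
    unfolding b_def using sqrt_iter_square[of "1 - k" n] by (simp del: sqrt_iter.simps)
  then have "q (b * b - k) = 2 * q (sqrt_iter (1 - k) (Suc n) - sqrt_iter (1 - k) n)"
    by (simp only: q_two)
  then have b: "q (b * b - k) < e / t"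
    using sqrt_iter_step[OF k, of n] n by (simp del: sqrt_iter.simps sqrt_bound.simps add: field_simps)
  define c where "c = complex_of_real (sqrt t) *\<^sub>C b"
  show thesis
  proof
    show "star c = c"
      by (simp add: c_def b_def star_simps star_sqrt_iter sk)
    show "z * c = c * z" if "z * h = h * z" for z
    proof -
      have "z * (1 - k) = (1 - k) * z"
        using that by (simp add: k_def algebra_simps smul_mult_left mult_smul_right)
      from sqrt_iter_commute[OF this, of n] show ?thesis
        by (simp add: c_def b_def algebra_simps smul_mult_left mult_smul_right)
    qed
    have eq: "c * c - h = complex_of_real t *\<^sub>C (b * b - k)"
      using t by (simp add: c_def h smul_mult_left mult_smul_right vs.scale_right_diff_distrib
          flip: of_real_mult)
    show "q (c * c - h) < e"
      unfolding eq q_smul using b t by (simp add: field_simps)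
  qed
qed

text \<open>For commuting self-adjoint \<open>r\<close> and \<open>c\<close> the element \<open>u = r + \<i> c\<close> satisfies
  \<open>u\<^sup>* u = r\<^sup>2 + c\<^sup>2\<close>, and \<open>c\<close> is its imaginary part.\<close>

lemma q_square_le_sum_squares:
  assumes "star r = r" "star c = c" "r * c = c * r"
  shows "q (c * c) \<le> q (r * r + c * c)"
proof -
  define u where "u = r + \<i> *\<^sub>C c"
  have su: "star u = r - \<i> *\<^sub>C c"
    by (simp add: u_def star_simps assms)
  have "star u * u = r * r + c * c"
    by (simp add: su) (simp add: u_def algebra_simps smul_mult_left mult_smul_right assms)
  then have u: "(q u)\<^sup>2 = q (r * r + c * c)"
    using q_C_star[of u] by simp
  have "u - star u = (2 * \<i>) *\<^sub>C c"
    by (simp add: su) (simp add: u_def flip: vs.scale_left_distrib)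
  then have "2 * q c \<le> 2 * q u"
    using q_diff[of u "star u"] by (simp add: q_star q_smul norm_mult)
  then have "(q c)\<^sup>2 \<le> (q u)\<^sup>2"
    by (simp add: power_mono q_nonneg)
  then show ?thesis using u by (simp add: q_square assms)
qed

text \<open>With \<open>c\<close> an approximate square root of \<open>t - r * r\<close>, the sum
  \<open>r * r + c * c\<close> is nearly the scalar \<open>t\<close> and dominates
  \<open>c * c\<close> in norm.\<close>

lemma q_emb_minus_square:
  assumes "star r = r" "q (r * r) \<le> t"
  shows "q (emb t - r * r) \<le> t"
proof (rule field_le_epsilon)
  fix e :: real assume "e > 0"
  have t: "0 \<le> t" using assms(2) q_nonneg order_trans by blast
  let ?h = "emb t - r * r"
  have "qpos ?h"
    unfolding qpos_def using assms t by (auto simp: star_simps star_emb intro!: exI[of _ t])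
  then obtain c where c: "star c = c" "\<And>z. z * ?h = ?h * z \<Longrightarrow> z * c = c * z" "q (c * c - ?h) < e/2"
    using approx_sqrt[OF _ half_gt_zero[OF \<open>e > 0\<close>]] by blast
  have "r * c = c * r"
    by (rule c) (simp add: algebra_simps emb_commute)
  then have "q (c * c) \<le> q (r * r + c * c)"
    by (rule q_square_le_sum_squares[OF assms(1) c(1)])
  also have "r * r + c * c = emb t + (c * c - ?h)" by simp
  also have "q \<dots> \<le> t + e/2"
    using q_add[of "emb t" "c * c - ?h"] q_emb[of t] c(3) t by simp
  finally show "q ?h \<le> t + e"
    using q_diff[of "c * c" "c * c - ?h"] c(3) by simp
qed

lemma qpos_square: "star r = r \<Longrightarrow> qpos (r * r)"
  unfolding qpos_def using q_emb_minus_square[of r "q (r * r)"] q_nonneg by (auto simp: star_simps)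

text \<open>Positivity provides some scalar \<open>t\<close>; this makes every \<open>t\<close>
  above \<open>q h\<close> admissible, by replacing \<open>h\<close> with a nearby square.\<close>

lemma qpos_bound:
  assumes "qpos h" "q h \<le> t" shows "q (emb t - h) \<le> t"
proof (rule field_le_epsilon)
  fix e :: real assume "e > 0"
  then have "e/3 > 0" by simp
  then obtain c where c: "star c = c" "q (c * c - h) < e/3"
    using approx_sqrt[OF assms(1)] by blast
  have "q (c * c) \<le> t + e/3"
    using q_add[of h "c * c - h"] assms c by simp
  then have "q (emb (t + e/3) - c * c) \<le> t + e/3"
    by (rule q_emb_minus_square[OF c(1)])
  moreover have eq: "emb t - h = (emb (t + e/3) - c * c) + (c * c - h) - emb (e/3)"
    by (simp add: emb_add)
  ultimately show "q (emb t - h) \<le> t + e"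
    unfolding eq using q_diff[of "(emb (t + e/3) - c * c) + (c * c - h)" "emb (e/3)"]
      q_add[of "emb (t + e/3) - c * c" "c * c - h"] q_emb[of "e/3"] c \<open>e > 0\<close>
    by linarith
qed

text \<open>By \<open>qpos_bound\<close> the approximants admit scalars close to \<open>q h\<close>,
  so the bound passes to the limit. The free constant \<open>C\<close> lets callers state errors up
  to a fixed factor.\<close>

lemma qpos_closed:
  assumes "star h = h" "\<And>e. e > 0 \<Longrightarrow> \<exists>k. qpos k \<and> q (k - h) \<le> C * e"
  shows "qpos h"
proof -
  have "q (emb (q h) - h) \<le> q h"
  proof (rule field_le_epsilon)
    fix e :: real assume "e > 0"
    define d where "d = e / (3 * (\<bar>C\<bar> + 1))"
    have d: "d > 0" using \<open>e > 0\<close> by (simp add: d_def add_nonneg_pos)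
    then obtain k where k: "qpos k" "q (k - h) \<le> C * d" using assms by blast
    have "C * d \<le> (\<bar>C\<bar> + 1) * d" using d by (intro mult_right_mono) auto
    also have "\<dots> = e/3" by (simp add: d_def field_simps add_nonneg_eq_0_iff)
    finally have kh: "q (k - h) \<le> e/3" using k by simp
    have "q k \<le> q h + e/3" using q_add[of h "k - h"] kh by simp
    then have "q (emb (q h + e/3) - k) \<le> q h + e/3" by (rule qpos_bound[OF k(1)])
    moreover have eq: "emb (q h) - h = (emb (q h + e/3) - k) + (k - h) - emb (e/3)"
      by (simp add: emb_add)
    ultimately show "q (emb (q h) - h) \<le> q h + e"
      unfolding eq using q_diff[of "(emb (q h + e/3) - k) + (k - h)" "emb (e/3)"]
        q_add[of "emb (q h + e/3) - k" "k - h"] q_emb[of "e/3"] kh \<open>e > 0\<close>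
      by linarith
  qed
  then show ?thesis unfolding qpos_def using assms q_nonneg by auto
qed

text \<open>Approximate square roots of \<open>a\<close> and of \<open>b - a\<close> commute, so the
  square for \<open>a\<close> is dominated by a sum of squares close to the scalar
  \<open>b\<close>.\<close>

lemma q_le_emb:
  assumes "qpos a" "qpos (emb b - a)" shows "q a \<le> \<bar>b\<bar>"
proof (rule field_le_epsilon)
  fix e :: real assume "e > 0"
  then have e: "e/3 > 0" by simp
  obtain r where r: "star r = r" "\<And>z. z * a = a * z \<Longrightarrow> z * r = r * z" "q (r * r - a) < e/3"
    using approx_sqrt[OF assms(1) e] by blast
  let ?h = "emb b - a"
  obtain c where c: "star c = c" "\<And>z. z * ?h = ?h * z \<Longrightarrow> z * c = c * z" "q (c * c - ?h) < e/3"
    using approx_sqrt[OF assms(2) e] by blast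
  have "a * c = c * a"
    by (rule c) (simp add: algebra_simps emb_commute)
  \<comment> \<open>\<open>r\<close> commutes with everything that commutes with \<open>a\<close>,
    in particular with \<open>c\<close>.\<close>
  then have "c * r = r * c" by (intro r(2)) (rule sym)
  then have "q (r * r) \<le> q (c * c + r * r)"
    by (rule q_square_le_sum_squares[OF c(1) r(1)])
  also have "c * c + r * r = emb b + (c * c - ?h) + (r * r - a)" by simp
  also have "q \<dots> \<le> \<bar>b\<bar> + e/3 + e/3"
    using q_add[of "emb b + (c * c - ?h)" "r * r - a"] q_add[of "emb b" "c * c - ?h"] q_emb[of b] r(3) c(3)
    by simp
  finally show "q a \<le> \<bar>b\<bar> + e"
    using q_diff[of "r * r" "r * r - a"] r(3) by simp
qed

lemma qpos_emb_minus:
  assumes "star b = b" "q b \<le> t" shows "qpos (emb t - b)"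
  unfolding qpos_def using assms q_nonneg order_trans[OF q_nonneg assms(2)]
  by (auto simp: star_simps star_emb intro!: exI[of _ t])

text \<open>From \<open>a \<le> b \<le> q b\<close> the comparison is reduced to one with a scalar,
  where everything commutes.\<close>

lemma q_mono:
  assumes "qpos a" "qpos (b - a)" shows "q a \<le> q b"
proof -
  have "star b = b"
    using qpos_star[OF qpos_add[OF assms]] by simp
  then have "qpos (emb (q b) - b + (b - a))"
    by (intro qpos_add qpos_emb_minus assms) simp_all
  then show ?thesis
    using q_le_emb[OF assms(1), of "q b"] q_nonneg[of b] by simp
qed

lemma qpos_antisym: "qpos a \<Longrightarrow> qpos (- a) \<Longrightarrow> q a = 0"
  using q_mono[of a 0] q_nonneg[of a] by (simp add: q_zero)

text \<open>If \<open>r * r\<close> approximates \<open>c\<close>, then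
  \<open>f * (r * r) * f\<close> is the square of the self-adjoint \<open>r * f\<close>.\<close>

lemma qpos_conj_commute:
  assumes "qpos c" "star f = f" "f * c = c * f" shows "qpos (f * c * f)"
proof (rule qpos_closed)
  show "star (f * c * f) = f * c * f"
    using assms by (metis star_mult qpos_star mult.assoc)
  fix e :: real assume "e > 0"
  then obtain r where r: "star r = r" "\<And>z. z * c = c * z \<Longrightarrow> z * r = r * z" "q (r * r - c) < e"
    using approx_sqrt[OF assms(1)] by blast
  have "f * r = r * f" by (intro r assms)
  then have "star (r * f) = r * f" and "f * (r * r) * f = (r * f) * (r * f)"
    by (simp_all only: star_mult r(1) assms(2)) (metis mult.assoc)
  then have "qpos (f * (r * r) * f)" using qpos_square by simp
  moreover have "f * (r * r) * f - f * c * f = f * (r * r - c) * f"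
    by (simp add: algebra_simps)
  moreover have "q (f * (r * r - c) * f) \<le> (q f * e) * q f"
    using r(3) by (intro q_mult_bound) simp_all
  ultimately show "\<exists>k. qpos k \<and> q (k - f * c * f) \<le> (q f * q f) * e"
    by (metis mult.commute mult.left_commute)
qed

text \<open>With \<open>r * r\<close> close to \<open>b\<close>, the product is close to
  \<open>r * a * r\<close>, to which the previous lemma applies.\<close>

lemma qpos_mult:
  assumes "qpos a" "qpos b" "a * b = b * a" shows "qpos (a * b)"
proof (rule qpos_closed)
  show "star (a * b) = a * b"
    using assms by (simp add: star_simps qpos_star)
  fix e :: real assume "e > 0"
  then obtain r where r: "star r = r" "\<And>z. z * b = b * z \<Longrightarrow> z * r = r * z" "q (r * r - b) < e"
    using approx_sqrt[OF assms(2)] by blast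
  have ar: "a * r = r * a" by (intro r assms)
  then have "qpos (r * a * r)"
    by (intro qpos_conj_commute assms(1) r(1) ar[symmetric])
  moreover have "r * a * r - a * b = a * (r * r - b)"
    by (simp only: right_diff_distrib ar[symmetric] mult.assoc)
  moreover have "q (a * (r * r - b)) \<le> q a * e"
    using r(3) by (intro q_mult_bound) simp_all
  ultimately show "\<exists>k. qpos k \<and> q (k - a * b) \<le> q a * e"
    by metis
qed

text \<open>For commuting \<open>a, b \<ge> 0\<close> one has \<open>(a - b)\<^sup>4 \<le> (a - b)\<^sup>2 (a + b)\<^sup>2 = (a\<^sup>2 - b\<^sup>2)\<^sup>2\<close>.\<close>

lemma q_diff_le_square_diff:
  assumes "qpos a" "qpos b" "a * b = b * a"
  shows "(q (a - b))\<^sup>2 \<le> q (a * a - b * b)"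
proof -
  let ?d = "a - b" and ?s = "a * a - b * b"
  have sd: "star ?d = ?d" "star ?s = ?s" "star (?d * ?d) = ?d * ?d"
    using assms by (simp_all add: star_simps qpos_star)
  have "?s = ?d * (a + b)" "?d * (a + b) = (a + b) * ?d"
    using assms by (simp_all add: algebra_simps)
  then have s2: "?s * ?s = ?d * ((a + b) * (a + b)) * ?d"
    by (metis mult.assoc)
  let ?e = "(a + b) * (a + b) - ?d * ?d"
  have e: "?e = 2 * (a * b) + 2 * (a * b)"
    using assms by (simp add: algebra_simps mult_2)
  have "qpos ?e"
    unfolding e mult_2 by (intro qpos_add qpos_mult assms)
  moreover have "?d * (a * b) = (a * b) * ?d"
    using assms by (simp add: algebra_simps) (metis assms(3) mult.assoc)
  then have "?d * ?e = ?e * ?d"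
    unfolding e by (simp only: distrib_left[of ?d] distrib_right[of _ _ ?d] mult_2)
  ultimately have "qpos (?d * ?e * ?d)"
    by (intro qpos_conj_commute sd)
  also have "?d * ?e * ?d = ?s * ?s - (?d * ?d) * (?d * ?d)"
  proof -
    have "d * (s - d * d) * d = d * s * d - (d * d) * (d * d)" for d s :: 'a
      by (simp add: algebra_simps)
    then show ?thesis unfolding s2 .
  qed
  finally have "q ((?d * ?d) * (?d * ?d)) \<le> q (?s * ?s)"
    by (intro q_mono qpos_square sd)
  then have "((q ?d)\<^sup>2)\<^sup>2 \<le> (q ?s)\<^sup>2"
    by (simp add: q_square[OF sd(1)] q_square[OF sd(2)] q_square[OF sd(3)])
  then show ?thesis
    using q_nonneg power2_le_imp_le by blast
qed

end

subsection \<open>Limits and invertibility in locally C*-algebras\<close>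

locale locally_C_star = star_algebra +
  fixes p :: "'i \<Rightarrow> 'a::ring_1 \<Rightarrow> real"
  assumes locally_C_star_algebra: "locally_C_star_algebra smul star p"
begin

sublocale sn: C_star_seminorm_algebra smul star "p i" for i
  using locally_C_star_algebra by unfold_locales (simp add: locally_C_star_algebra_def)

lemma directed: "\<exists>k. \<forall>x. p i x \<le> p k x \<and> p j x \<le> p k x"
  and separating: "(\<And>i. p i x = 0) \<Longrightarrow> x = 0"
  and complete: "F \<noteq> bot \<Longrightarrow> sn_cauchy p F \<Longrightarrow> \<exists>x. sn_converges p F x"
  using locally_C_star_algebra unfolding locally_C_star_algebra_def by auto

section \<open>Convergence of sequences\<close>

definition tends :: "(nat \<Rightarrow> 'a) \<Rightarrow> 'a \<Rightarrow> bool" where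
  "tends X L \<longleftrightarrow> (\<forall>i. (\<lambda>n. p i (X n - L)) \<longlonglongrightarrow> 0)"

lemma tendsI:
  assumes "\<And>i. (f i) \<longlonglongrightarrow> 0" "\<And>i n. p i (X n - L) \<le> f i n"
  shows "tends X L"
  unfolding tends_def
proof
  show "(\<lambda>n. p i (X n - L)) \<longlonglongrightarrow> 0" for i
    by (rule tendsto_sandwich[OF _ _ tendsto_const assms(1)[of i]])
      (simp_all add: sn.q_nonneg assms(2))
qed

lemma tendsD: "tends X L \<Longrightarrow> (\<lambda>n. p i (X n - L)) \<longlonglongrightarrow> 0"
  by (simp add: tends_def)

lemma tends_const: "tends (\<lambda>n. x) x"
  by (simp add: tends_def sn.q_zero)

lemma tends_unique:
  assumes "tends X a" "tends X b" shows "a = b"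
proof -
  have "p i (a - b) = 0" for i
  proof -
    have "p i (a - b) \<le> p i (X n - a) + p i (X n - b)" for n
      using sn.q_diff[of i "X n - b" "X n - a"] by simp
    moreover have "(\<lambda>n. p i (X n - a) + p i (X n - b)) \<longlonglongrightarrow> 0"
      using tendsto_add[OF tendsD[OF assms(1)] tendsD[OF assms(2)]] by simp
    ultimately have "p i (a - b) \<le> 0"
      by (intro LIMSEQ_le_const) auto
    then show ?thesis using sn.q_nonneg[of i "a - b"] by simp
  qed
  then show ?thesis using separating[of "a - b"] by simp
qed

lemma tends_add:
  assumes "tends X a" "tends Y b" shows "tends (\<lambda>n. X n + Y n) (a + b)"
proof (rule tendsI)
  show "(\<lambda>n. p i (X n - a) + p i (Y n - b)) \<longlonglongrightarrow> 0" for i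
    using tendsto_add[OF tendsD[OF assms(1)] tendsD[OF assms(2)]] by simp
  show "p i (X n + Y n - (a + b)) \<le> p i (X n - a) + p i (Y n - b)" for i n
    using sn.q_add[of i "X n - a" "Y n - b"] by (simp add: algebra_simps)
qed

lemma tends_star:
  assumes "tends X a" shows "tends (\<lambda>n. star (X n)) (star a)"
  using assms by (simp add: tends_def sn.q_star flip: star_diff)

lemma tends_mult:
  assumes "tends X a" "tends Y b" shows "tends (\<lambda>n. X n * Y n) (a * b)"
proof (rule tendsI)
  let ?f = "\<lambda>i n. p i (X n - a) * p i (Y n - b) + p i (X n - a) * p i b + p i a * p i (Y n - b)"
  show "?f i \<longlonglongrightarrow> 0" for i
    by (rule tendsto_eq_rhs[OF tendsto_add[OF tendsto_add[OF
          tendsto_mult[OF tendsD[OF assms(1)] tendsD[OF assms(2)]]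
          tendsto_mult[OF tendsD[OF assms(1)] tendsto_const]]
          tendsto_mult[OF tendsto_const tendsD[OF assms(2)]]]]) simp
  show "p i (X n * Y n - a * b) \<le> ?f i n" for i n
  proof -
    have eq: "X n * Y n - a * b = (X n - a) * (Y n - b) + (X n - a) * b + a * (Y n - b)"
      by (simp add: algebra_simps)
    show ?thesis
      unfolding eq
      using sn.q_add[of i "(X n - a) * (Y n - b) + (X n - a) * b" "a * (Y n - b)"]
        sn.q_add[of i "(X n - a) * (Y n - b)" "(X n - a) * b"]
        sn.q_mult[of i "X n - a" "Y n - b"] sn.q_mult[of i "X n - a" b] sn.q_mult[of i a "Y n - b"]
      by linarith
  qed
qed

lemma tends_diff:
  assumes "tends X a" "tends Y b" shows "tends (\<lambda>n. X n - Y n) (a - b)"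
  using tends_add[OF assms(1) tends_mult[OF tends_const[of "-1"] assms(2)]] by simp

lemma Cauchy_tends:
  assumes "\<And>i e. e > 0 \<Longrightarrow> \<exists>N. \<forall>m\<ge>N. \<forall>n\<ge>N. p i (X m - X n) < e"
  shows "\<exists>L. tends X L"
proof -
  let ?F = "filtermap X sequentially"
  have "sn_cauchy p ?F"
    unfolding sn_cauchy_def
  proof (intro allI impI)
    fix i and e :: real assume "e > 0"
    then obtain N where N: "\<forall>m\<ge>N. \<forall>n\<ge>N. p i (X m - X n) < e" using assms by blast
    show "\<forall>\<^sub>F (x, y) in ?F \<times>\<^sub>F ?F. p i (x - y) < e"
      unfolding eventually_prod_same
      using N by (intro exI[of _ "\<lambda>x. \<exists>n\<ge>N. x = X n"])
        (auto simp: eventually_filtermap eventually_sequentially)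
  qed
  then obtain L where "sn_converges p ?F L"
    using complete[of ?F] by (auto simp: filtermap_bot_iff)
  then have "tends X L"
    unfolding tends_def sn_converges_def tendsto_iff
    by (simp add: eventually_filtermap sn.q_nonneg)
  then show ?thesis ..
qed

lemma closed_tends:
  assumes "sn_closed p S" "\<And>n. X n \<in> S" "tends X L" shows "L \<in> S"
proof -
  have "\<exists>y\<in>S. p i (L - y) < e" if "e > 0" for i e
  proof -
    have "eventually (\<lambda>n. p i (X n - L) < e) sequentially"
      using tendsD[OF assms(3)] that by (rule order_tendstoD)
    then obtain n where "p i (X n - L) < e"
      by (auto simp: eventually_sequentially)
    then show ?thesis using assms(2) sn.q_minus_commute by metis
  qed
  then show ?thesis using assms(1) unfolding sn_closed_def by blast
qed

section \<open>Inverses from approximate inverses at each seminorm\<close>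

definition approx_inverses :: "'a \<Rightarrow> 'i \<Rightarrow> real \<Rightarrow> 'a set" where
  "approx_inverses b i e = {y. p i (1 - b * y) < e \<and> p i (1 - y * b) < e}"

text \<open>The Newton step \<open>y \<mapsto> 2 y - y b y\<close> squares both defects \<open>1 - b y\<close> and \<open>1 - y b\<close>.\<close>

lemma approx_inverses_improve:
  assumes "y \<in> approx_inverses b i 1" "e > 0"
  shows "approx_inverses b i e \<noteq> {}"
proof -
  define r where "r = max (p i (1 - b * y)) (p i (1 - y * b))"
  have r: "0 \<le> r" "r < 1"
    using assms by (auto simp: r_def approx_inverses_def sn.q_nonneg le_max_iff_disj)
  have "\<exists>y. p i (1 - b * y) \<le> r ^ (2 ^ n) \<and> p i (1 - y * b) \<le> r ^ (2 ^ n)" for n :: nat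
  proof (induction n)
    case 0
    then show ?case by (intro exI[of _ y]) (simp add: r_def)
  next
    case (Suc n)
    then obtain y where y: "p i (1 - b * y) \<le> r ^ (2 ^ n)" "p i (1 - y * b) \<le> r ^ (2 ^ n)" by blast
    let ?y = "2 * y - y * b * y"
    have "1 - b * ?y = (1 - b * y) * (1 - b * y)" "1 - ?y * b = (1 - y * b) * (1 - y * b)"
      by (simp_all add: algebra_simps mult_2 mult_2_right)
    then show ?case
      using sn.q_mult_bound[OF y(1) y(1)] sn.q_mult_bound[OF y(2) y(2)]
      by (intro exI[of _ ?y]) (simp add: power2_eq_square power_mult mult.commute power_add mult_2)
  qed
  moreover obtain n where "r ^ n < e"
    using real_arch_pow_inv[OF assms(2) r(2)] by blast
  moreover have "r ^ (2 ^ n) \<le> r ^ n"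
    using r by (intro power_decreasing) (auto intro: less_imp_le less_exp)
  ultimately show ?thesis
    unfolding approx_inverses_def by (fastforce intro: le_less_trans order_trans)
qed

text \<open>In \<open>x = y * (b * x) + (1 - y * b) * x\<close> the last term is at most half of
  \<open>p i x\<close> and can be absorbed. One approximate inverse thus bounds all others.\<close>

lemma approx_inverses_bound:
  assumes "y \<in> approx_inverses b i (1/2)" "x \<in> approx_inverses b i (1/2)"
  shows "p i x \<le> 4 * p i y"
proof -
  have "p i (b * x) \<le> 2"
    using assms sn.q_diff[of i 1 "1 - b * x"] sn.q_one[of i] by (simp add: approx_inverses_def)
  then have "p i (y * (b * x)) \<le> p i y * 2"
    by (intro sn.q_mult_bound) simp
  moreover have "p i ((1 - y * b) * x) \<le> 1/2 * p i x"
    using assms by (intro sn.q_mult_bound) (simp_all add: approx_inverses_def)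
  moreover have "x = y * (b * x) + (1 - y * b) * x"
    by (simp add: algebra_simps)
  ultimately show ?thesis
    using sn.q_add[of i "y * (b * x)" "(1 - y * b) * x"] by simp
qed

text \<open>Directedness makes the sets of approximate inverses a filter base, and the uniform bound
  makes the filter Cauchy; its limit is a two-sided inverse. A filter handles index families of any
  cardinality.\<close>

lemma invertible_local:
  assumes "\<And>i. approx_inverses b i 1 \<noteq> {}"
  shows "invertible_el b"
proof -
  define F where "F = (INF k\<in>{k. snd k > 0}. principal (approx_inverses b (fst k) (snd k)))"
  have ev: "eventually P F \<longleftrightarrow> (\<exists>i e. e > 0 \<and> (\<forall>x\<in>approx_inverses b i e. P x))" for P
    unfolding F_def
  proof (subst eventually_INF_base)
    show "{k::'i \<times> real. snd k > 0} \<noteq> {}" by (auto intro!: exI[of _ "1::real"])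
    fix k l :: "'i \<times> real" assume kl: "k \<in> {k. snd k > 0}" "l \<in> {k. snd k > 0}"
    obtain j where j: "\<And>x. p (fst k) x \<le> p j x \<and> p (fst l) x \<le> p j x"
      using directed by metis
    have "approx_inverses b j (min (snd k) (snd l))
        \<subseteq> approx_inverses b (fst k) (snd k) \<inter> approx_inverses b (fst l) (snd l)"
      unfolding approx_inverses_def using j by (auto intro: le_less_trans)
    then show "\<exists>x\<in>{k. 0 < snd k}. principal (approx_inverses b (fst x) (snd x))
        \<le> inf (principal (approx_inverses b (fst k) (snd k)))
             (principal (approx_inverses b (fst l) (snd l)))"
      using kl by (intro bexI[of _ "(j, min (snd k) (snd l))"]) auto
  qed (auto simp: eventually_principal)
  have ne: "approx_inverses b i e \<noteq> {}" if "e > 0" for i e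
    using assms approx_inverses_improve that by blast
  have bot: "F \<noteq> bot"
    unfolding trivial_limit_def ev using ne by blast
  have mem: "eventually (\<lambda>x. x \<in> approx_inverses b i e) F" if "e > 0" for i e
    unfolding ev using that by blast
  have "sn_cauchy p F"
    unfolding sn_cauchy_def
  proof (intro allI impI)
    fix i and e :: real assume "e > 0"
    obtain y where y: "y \<in> approx_inverses b i (1/2)" using ne[of "1/2" i] by auto
    define M where "M = 4 * p i y"
    have M: "M \<ge> 0" by (simp add: M_def sn.q_nonneg)
    \<comment> \<open>The \<open>1/2\<close> makes the bound \<open>M\<close> available; the
      \<open>+ 1\<close> keeps the denominator positive when \<open>M = 0\<close>.\<close>
    define d where "d = min (1/2) (e / (2 * M + 1))"
    have d: "d > 0" "d \<le> 1/2" "2 * M * d < e"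
    proof -
      have "d \<le> e / (2 * M + 1)" by (simp add: d_def)
      then have "d * (2 * M + 1) \<le> e" using M by (simp add: field_simps)
      moreover show "d > 0" using M \<open>e > 0\<close> by (simp add: d_def)
      ultimately show "2 * M * d < e" by (simp add: algebra_simps)
      show "d \<le> 1/2" unfolding d_def by (rule min.cobounded1)
    qed
    show "\<forall>\<^sub>F (x, y) in F \<times>\<^sub>F F. p i (x - y) < e"
      unfolding eventually_prod_same
    proof (intro exI conjI allI impI)
      show "eventually (\<lambda>x. x \<in> approx_inverses b i d) F" by (rule mem[OF d(1)])
      fix x x' assume x: "x \<in> approx_inverses b i d" "x' \<in> approx_inverses b i d"
      then have "x \<in> approx_inverses b i (1/2)" "x' \<in> approx_inverses b i (1/2)"
        using d by (auto simp: approx_inverses_def)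
      then have "p i x \<le> M" "p i x' \<le> M"
        using approx_inverses_bound[OF y] by (auto simp: M_def)
      moreover have "p i (1 - b * x') \<le> d" "p i (1 - x * b) \<le> d"
        using x by (auto simp: approx_inverses_def)
      ultimately have "p i (x * (1 - b * x')) \<le> M * d" "p i ((1 - x * b) * x') \<le> d * M"
        by (auto intro: sn.q_mult_bound)
      \<comment> \<open>Each product pairs one small defect with one factor bounded by
        \<open>M\<close>.\<close>
      moreover have eq: "x - x' = x * (1 - b * x') - (1 - x * b) * x'"
        by (simp add: algebra_simps)
      ultimately have "p i (x - x') < e"
        unfolding eq using sn.q_diff[of i "x * (1 - b * x')" "(1 - x * b) * x'"] d(3)
        by argo
      then show "case (x, x') of (x, y) \<Rightarrow> p i (x - y) < e" by simp
    qed
  qed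
  then obtain z where z: "sn_converges p F z" using complete[OF bot] by blast
  have "p i (1 - b * z) \<le> 0 \<and> p i (1 - z * b) \<le> 0" for i
  proof -
    have *: "p i (1 - b * z) \<le> (1 + p i b) * e \<and> p i (1 - z * b) \<le> (1 + p i b) * e" if "e > 0" for e
    proof -
      have "eventually (\<lambda>y. p i (y - z) < e \<and> y \<in> approx_inverses b i e) F"
        using z mem that unfolding sn_converges_def by (intro eventually_conj) auto
      then obtain y where y: "p i (y - z) < e" "y \<in> approx_inverses b i e"
        using eventually_happens bot by blast
      have eq: "1 - b * z = (1 - b * y) + b * (y - z)" "1 - z * b = (1 - y * b) + (y - z) * b"
        by (simp_all add: algebra_simps)
      have "p i (b * (y - z)) \<le> p i b * e" "p i ((y - z) * b) \<le> e * p i b"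
        using y by (auto intro: sn.q_mult_bound)
      then show ?thesis
        using y sn.q_add[of i "1 - b * y" "b * (y - z)"] sn.q_add[of i "1 - y * b" "(y - z) * b"]
        unfolding eq approx_inverses_def by (simp add: algebra_simps)
    qed
    have "p i (1 - b * z) \<le> 0 + e \<and> p i (1 - z * b) \<le> 0 + e" if "e > 0" for e
    proof -
      have "1 + p i b > 0" using sn.q_nonneg[of i b] by linarith
      then show ?thesis using *[of "e / (1 + p i b)"] that by simp
    qed
    then show ?thesis using field_le_epsilon[of _ "0::real"] by blast
  qed
  then have "1 - b * z = 0" "1 - z * b = 0"
    using separating sn.q_nonneg by (meson order_antisym)+
  then show ?thesis
    unfolding invertible_el_def by (intro exI[of _ z]) simp
qed

text \<open>The scalar \<open>1 / c\<close> is an approximate inverse with both defects below 1. The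
  scalar \<open>c\<close> may depend on the seminorm.\<close>

lemma invertible_near_scalar:
  assumes "\<And>i. \<exists>c. p i (c *\<^sub>C 1 - b) < cmod c"
  shows "invertible_el b"
proof (rule invertible_local)
  fix i
  obtain c where c: "p i (c *\<^sub>C 1 - b) < cmod c" using assms by blast
  have c0: "c \<noteq> 0" using c sn.q_nonneg[of i "c *\<^sub>C 1 - b"] by auto
  let ?y = "(1 / c) *\<^sub>C 1"
  have "1 - b * ?y = (1 / c) *\<^sub>C (c *\<^sub>C 1 - b)" "1 - ?y * b = (1 / c) *\<^sub>C (c *\<^sub>C 1 - b)"
    using c0 by (simp_all add: smul_mult_left mult_smul_right vs.scale_right_diff_distrib)
  then have "?y \<in> approx_inverses b i 1"
    using c c0 by (simp add: approx_inverses_def sn.q_smul norm_divide)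
  then show "approx_inverses b i 1 \<noteq> {}" by blast
qed

subsection \<open>Positivity and the spectrum\<close>

definition pos :: "'a \<Rightarrow> bool" where
  "pos h \<longleftrightarrow> (\<forall>i. sn.qpos i h)"

lemma pos_star: "pos h \<Longrightarrow> star h = h"
  by (simp add: pos_def sn.qpos_def)

lemma pos_add: "pos a \<Longrightarrow> pos b \<Longrightarrow> pos (a + b)"
  and pos_scale: "pos a \<Longrightarrow> 0 \<le> r \<Longrightarrow> pos (complex_of_real r *\<^sub>C a)"
  and pos_emb: "0 \<le> r \<Longrightarrow> pos (emb r)"
  and pos_one: "pos 1"
  and pos_square: "star a = a \<Longrightarrow> pos (a * a)"
  and pos_mult: "pos a \<Longrightarrow> pos b \<Longrightarrow> a * b = b * a \<Longrightarrow> pos (a * b)"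
  and p_mono: "pos a \<Longrightarrow> pos (b - a) \<Longrightarrow> p i a \<le> p i b"
  unfolding pos_def
  by (simp_all add: sn.qpos_add sn.qpos_scale sn.qpos_emb sn.qpos_one sn.qpos_square sn.qpos_mult
      sn.q_mono)

lemma pos_conj_commute: "pos a \<Longrightarrow> star f = f \<Longrightarrow> f * a = a * f \<Longrightarrow> pos (f * a * f)"
  unfolding pos_def by (intro allI sn.qpos_conj_commute) blast+

lemma pos_antisym: "pos a \<Longrightarrow> pos (- a) \<Longrightarrow> a = 0"
  unfolding pos_def using sn.qpos_antisym separating by blast

lemma pos_tends:
  assumes "\<And>n. pos (X n)" "tends X L" shows "pos L"
  unfolding pos_def
proof
  fix i
  have "tends X (star L)"
    using tends_star[OF assms(2)] assms(1) by (simp add: pos_star)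
  then have "star L = L" using assms(2) tends_unique by blast
  then show "sn.qpos i L"
  proof (rule sn.qpos_closed[where C = 1])
    fix e :: real assume "e > 0"
    have "eventually (\<lambda>n. p i (X n - L) < e) sequentially"
      using tendsD[OF assms(2)] \<open>e > 0\<close> by (rule order_tendstoD)
    then obtain n where "p i (X n - L) < e"
      by (auto simp: eventually_sequentially)
    then show "\<exists>k. sn.qpos i k \<and> p i (k - L) \<le> 1 * e"
      using assms(1) unfolding pos_def by (auto intro!: exI[of _ "X n"])
  qed
qed

text \<open>For each seminorm a scalar \<open>c\<close> is found that is closer to
  \<open>z - h\<close> than to 0: a negative \<open>z\<close> is shifted left by
  \<open>p i h\<close>, a non-real \<open>z\<close> along the imaginary direction.\<close>

lemma pos_invertible:
  assumes "pos h" "\<not> (Im z = 0 \<and> 0 \<le> Re z)"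
  shows "invertible_el (z *\<^sub>C 1 - h)"
proof (rule invertible_near_scalar)
  fix i
  have sh: "star h = h" using assms(1) by (rule pos_star)
  show "\<exists>c. p i (c *\<^sub>C 1 - (z *\<^sub>C 1 - h)) < cmod c"
  proof (cases "Im z = 0")
    case True
    then have z: "Re z < 0" using assms by simp
    let ?t = "p i h"
    have eq: "(z - complex_of_real ?t) *\<^sub>C 1 - (z *\<^sub>C 1 - h) = - (emb ?t - h)"
      by (simp add: emb_def vs.scale_left_diff_distrib)
    have "p i (- (emb ?t - h)) \<le> ?t"
      unfolding sn.q_minus using assms(1) unfolding pos_def by (intro sn.qpos_bound) auto
    moreover have "\<bar>Re (z - complex_of_real ?t)\<bar> \<le> cmod (z - complex_of_real ?t)"
      by (rule abs_Re_le_cmod)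
    ultimately show ?thesis
      using z unfolding eq[symmetric]
      by (intro exI[of _ "z - complex_of_real ?t"]) auto
  next
    case False
    \<comment> \<open>This \<open>l\<close> satisfies
      \<open>- 2 * Im z * l = (p i h)\<^sup>2\<close>, so the cross term of
      \<open>(Im z - l)\<^sup>2\<close> compensates the norm of \<open>h\<close>.\<close>
    define l where "l = - (p i h)\<^sup>2 / (2 * Im z)"
    let ?k = "h - (\<i> * l) *\<^sub>C 1"
    have sk: "star ?k = h + (\<i> * l) *\<^sub>C 1"
      by (simp add: star_simps sh)
    have "star ?k * ?k = h * h + emb (l\<^sup>2)"
      unfolding sk by (simp add: algebra_simps smul_mult_left mult_smul_right emb_def power2_eq_square)
    then have "(p i ?k)\<^sup>2 \<le> (p i h)\<^sup>2 + l\<^sup>2"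
      using sn.q_C_star[of i ?k] sn.q_add[of i "h * h" "emb (l\<^sup>2)"] sn.q_emb[of i "l\<^sup>2"]
      by (simp add: sn.q_square sh)
    also have "\<dots> < (Re z)\<^sup>2 + (Im z - l)\<^sup>2"
    proof -
      have "(Im z)\<^sup>2 > 0" using False by simp
      moreover have "2 * Im z * l = - (p i h)\<^sup>2" using False by (simp add: l_def)
      then have "(Im z - l)\<^sup>2 = (Im z)\<^sup>2 + (p i h)\<^sup>2 + l\<^sup>2" by (simp add: power2_diff)
      ultimately show ?thesis using zero_le_power2[of "Re z"] by linarith
    qed
    also have "\<dots> = (cmod (z - \<i> * l))\<^sup>2" by (simp add: cmod_power2)
    finally have "p i ?k < cmod (z - \<i> * l)"
      by (rule power2_less_imp_less) simp
    then show ?thesis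
      by (intro exI[of _ "z - \<i> * l"]) (simp add: vs.scale_left_diff_distrib)
  qed
qed

lemma pos_imp_positive_el: "pos h \<Longrightarrow> positive_el smul star h"
  unfolding positive_el_def alg_spectrum_def using pos_star pos_invertible by blast

lemma inverse_commute:
  assumes "b * y = 1" "y * b = (1::'a)" "z * b = b * z" shows "z * y = y * z"
  using assms by (metis mult.assoc mult.left_neutral mult.right_neutral)

lemma inverse_star:
  assumes "b * y = 1" "y * b = 1" "star b = b" shows "star y = y"
proof -
  have "b * star y = 1"
    using assms by (metis star_mult star_one)
  then show ?thesis
    using assms by (metis mult.assoc mult.left_neutral mult.right_neutral)
qed

text \<open>If \<open>s\<^sub>0\<close> is the least \<open>s \<ge> 0\<close> with \<open>h + s \<ge> 0\<close> and \<open>s\<^sub>0 > 0\<close>, then \<open>w = h + s\<^sub>0\<close> is invertible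
  and \<open>w - 1/m = w (m - w\<^sup>-\<^sup>1) / m \<ge> 0\<close> for large \<open>m\<close>, contradicting minimality.\<close>

lemma positive_el_imp_pos:
  assumes "positive_el smul star h" shows "pos h"
  unfolding pos_def
proof
  fix i
  have sh: "star h = h" using assms by (simp add: positive_el_def)
  define S where "S = {s. 0 \<le> s \<and> sn.qpos i (emb s + h)}"
  have S: "p i h \<in> S"
    using sn.qpos_emb_minus[of "- h" i "p i h"]
    by (simp add: S_def sn.q_nonneg sn.q_minus star_simps sh)
  have bdd: "bdd_below S" by (auto simp: S_def intro: bdd_belowI)
  define s where "s = Inf S"
  have "s \<ge> 0" unfolding s_def using S by (intro cInf_greatest) (auto simp: S_def)
  have "sn.qpos i (emb s + h)"
  proof (rule sn.qpos_closed[where C = 1])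
    show "star (emb s + h) = emb s + h" by (simp add: star_simps star_emb sh)
    fix e :: real assume "e > 0"
    then obtain t where t: "t \<in> S" "t < s + e"
      using S cInf_lessD[of S "s + e"] by (auto simp: s_def)
    have "s \<le> t" unfolding s_def using t bdd by (intro cInf_lower)
    have "emb t + h - (emb s + h) = emb (t - s)" by (simp add: emb_diff)
    then have "p i (emb t + h - (emb s + h)) \<le> 1 * e"
      using sn.q_emb[of i "t - s"] \<open>s \<le> t\<close> t(2) by simp
    then show "\<exists>k. sn.qpos i k \<and> p i (k - (emb s + h)) \<le> 1 * e"
      using t(1) by (auto simp: S_def)
  qed
  moreover have "s = 0"
  proof (rule ccontr)
    assume "s \<noteq> 0"
    then have "s > 0" using \<open>s \<ge> 0\<close> by simp
    let ?w = "emb s + h"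
    have "invertible_el (complex_of_real (- s) *\<^sub>C 1 - h)"
      using assms \<open>s > 0\<close> unfolding positive_el_def alg_spectrum_def by fastforce
    then have "invertible_el (- ?w)"
      by (simp add: emb_def)
    then obtain v' where "- ?w * v' = 1" "v' * - ?w = 1"
      unfolding invertible_el_def by blast
    then obtain v where v: "?w * v = 1" "v * ?w = 1"
      by (metis minus_mult_commute)
    have sw: "star ?w = ?w" by (simp add: star_simps star_emb sh)
    have sv: "star v = v" using v sw by (rule inverse_star)
    \<comment> \<open>The first bound makes \<open>m - v\<close> positive, the second keeps
      \<open>s - 1 / m\<close> nonnegative.\<close>
    define m where "m = max (p i v) (1 / s)"
    have m: "m > 0" using \<open>s > 0\<close> by (simp add: m_def less_max_iff_disj)
    have "1 / s \<le> m" by (simp add: m_def)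
    then have ms: "1 / m \<le> s" using m \<open>s > 0\<close> by (simp add: field_simps)
    have "sn.qpos i (emb m - v)"
      by (rule sn.qpos_emb_minus[OF sv]) (simp add: m_def)
    then have "sn.qpos i (?w * (emb m - v))"
      by (rule sn.qpos_mult[OF \<open>sn.qpos i ?w\<close>])
        (simp only: right_diff_distrib left_diff_distrib v emb_commute)
    then have "sn.qpos i (complex_of_real (1 / m) *\<^sub>C (?w * (emb m - v)))"
      using m by (intro sn.qpos_scale) auto
    also have "complex_of_real (1 / m) *\<^sub>C (?w * (emb m - v)) = ?w - emb (1 / m)"
      using m by (simp only: right_diff_distrib v)
        (simp add: emb_def vs.scale_right_diff_distrib mult_smul_right)
    finally have "sn.qpos i (emb (s - 1 / m) + h)"
      by (simp add: emb_diff algebra_simps)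
    then have "s - 1 / m \<in> S" using ms by (simp add: S_def)
    then have "s \<le> s - 1 / m" unfolding s_def by (intro cInf_lower bdd)
    then show False using m by simp
  qed
  ultimately show "sn.qpos i h" by (simp add: emb_def)
qed

lemma positive_el_iff_pos: "positive_el smul star h \<longleftrightarrow> pos h"
  using pos_imp_positive_el positive_el_imp_pos by blast

lemma pos_half:
  assumes "pos (x + x)" shows "pos x"
proof -
  have "complex_of_real (1/2) *\<^sub>C (x + x) = x"
    using two_half[of x] by (simp add: vs.scale_right_distrib)
  then show ?thesis using pos_scale[OF assms, of "1/2"] by simp
qed

subsection \<open>Square roots and absolute values\<close>

text \<open>The inverse of \<open>e + h\<close>. For \<open>h \<ge> 0\<close> and \<open>e\<close>
  tending to 0, \<open>h * resolvent h e\<close> acts as an approximate unit for \<open>h\<close>,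
  with complement \<open>emb e * resolvent h e\<close>.\<close>

definition resolvent :: "'a \<Rightarrow> real \<Rightarrow> 'a" where
  "resolvent h e = (SOME f. (emb e + h) * f = 1 \<and> f * (emb e + h) = 1)"

context
  fixes h and e :: real assumes h: "pos h" and e: "e > 0"
begin

lemma resolvent: "(emb e + h) * resolvent h e = 1" "resolvent h e * (emb e + h) = 1"
proof -
  have "invertible_el (complex_of_real (- e) *\<^sub>C 1 - h)"
    using h e by (intro pos_invertible) auto
  then obtain f where "- (emb e + h) * f = 1" "f * - (emb e + h) = 1"
    by (auto simp: invertible_el_def emb_def)
  then have "\<exists>f. (emb e + h) * f = 1 \<and> f * (emb e + h) = 1"
    by (metis minus_mult_commute)
  from someI_ex[OF this] show "(emb e + h) * resolvent h e = 1" "resolvent h e * (emb e + h) = 1"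
    by (auto simp: resolvent_def)
qed

lemma resolvent_commute: "z * h = h * z \<Longrightarrow> z * resolvent h e = resolvent h e * z"
  by (rule inverse_commute[OF resolvent]) (simp add: distrib_left distrib_right emb_commute)

lemma resolvent_star: "star (resolvent h e) = resolvent h e"
  using resolvent by (rule inverse_star) (simp add: star_simps star_emb pos_star h)

lemma pos_resolvent: "pos (resolvent h e)"
proof -
  have "pos (resolvent h e * (emb e + h) * resolvent h e)"
    using h e by (intro pos_conj_commute pos_add pos_emb resolvent_star) (simp_all add: resolvent)
  then show ?thesis by (simp add: resolvent)
qed

lemma resolvent_sum: "emb e * resolvent h e + h * resolvent h e = 1"
  using resolvent(1) by (simp add: distrib_right)

lemma pos_mult_resolvent: "pos (h * resolvent h e)"
  by (intro pos_mult h pos_resolvent resolvent_commute) simp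

lemma pos_emb_resolvent: "pos (emb e * resolvent h e)"
  using e by (intro pos_mult pos_emb pos_resolvent) (simp_all add: emb_commute)

text \<open>The positive elements \<open>h * resolvent h e\<close> and
  \<open>emb e * resolvent h e\<close> add up to 1, so monotonicity bounds each by
  \<open>p i 1\<close>.\<close>

lemma p_mult_resolvent: "p i (h * resolvent h e) \<le> 1"
  using p_mono[of "h * resolvent h e" 1 i] pos_mult_resolvent pos_emb_resolvent
    sn.q_one[of i] by (simp add: resolvent_sum[symmetric])

lemma p_emb_resolvent: "p i (emb e * resolvent h e) \<le> 1"
  using p_mono[of "emb e * resolvent h e" 1 i] pos_mult_resolvent pos_emb_resolvent
    sn.q_one[of i] by (simp add: resolvent_sum[symmetric])

end

text \<open>The majorant \<open>sqrt_bound\<close> serves all seminorms at once, so the iteration is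
  Cauchy. A general positive element cannot be scaled into this situation, because its seminorms may
  be unbounded over \<open>i\<close>.\<close>

lemma contractive_sqrt_exists:
  assumes "star k = k" "\<And>i. p i (1 - k) \<le> 1"
  shows "\<exists>c. pos c \<and> c * c = k \<and> (\<forall>z. z * k = k * z \<longrightarrow> z * c = c * z)"
proof -
  define Y where "Y = sqrt_iter (1 - k)"
  have "\<exists>N. \<forall>m\<ge>N. \<forall>n\<ge>N. p i (Y m - Y n) < e" if "e > 0" for i e
  proof -
    from CauchyD[OF convergent_Cauchy[OF sqrt_bound_convergent] that]
    obtain N where N: "\<forall>m\<ge>N. \<forall>n\<ge>N. \<bar>sqrt_bound m - sqrt_bound n\<bar> < e"
      by auto
    have "p i (Y m - Y n) < e" if "m \<ge> N" "n \<ge> N" for m n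
      using sn.sqrt_iter_diff[OF assms(2), of i m n] N that unfolding Y_def
      by (meson le_less_trans)
    then show ?thesis by blast
  qed
  then obtain L where L: "tends Y L" using Cauchy_tends by blast
  let ?c = "1 - L"
  have c: "tends (\<lambda>n. 1 - Y n) ?c" by (intro tends_diff tends_const L)
  have "sn.qpos i (1 - Y n)" for i n
    unfolding sn.qpos_def
  proof (intro conjI exI[of _ 1])
    show "star (1 - Y n) = 1 - Y n"
      by (simp add: Y_def star_simps star_sqrt_iter assms)
    show "p i (emb 1 - (1 - Y n)) \<le> 1"
      using sn.sqrt_iter_bound[OF assms(2), of i n] sqrt_bound_bounds[of n]
      by (simp add: emb_1 Y_def)
  qed simp
  then have "pos ?c"
    using pos_tends[OF _ c] by (simp add: pos_def)
  moreover have "?c * ?c = k"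
  proof (rule tends_unique)
    show "tends (\<lambda>n. (1 - Y n) * (1 - Y n)) (?c * ?c)" by (intro tends_mult c)
    show "tends (\<lambda>n. (1 - Y n) * (1 - Y n)) k"
    proof (rule tendsI)
      show "(\<lambda>n. 2 * (sqrt_bound (Suc n) - sqrt_bound n)) \<longlonglongrightarrow> 0"
        using tendsto_mult_right_zero[OF sqrt_bound_step] .
      show "p i ((1 - Y n) * (1 - Y n) - k) \<le> 2 * (sqrt_bound (Suc n) - sqrt_bound n)" for i n
      proof -
        have eq: "(1 - Y n) * (1 - Y n) - k = 2 * (Y (Suc n) - Y n)"
          using sqrt_iter_square[of "1 - k" n] by (simp add: Y_def del: sqrt_iter.simps)
        show ?thesis
          using sn.sqrt_iter_step[OF assms(2), of i n] unfolding eq sn.q_two unfolding Y_def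
          by (rule mult_left_mono) simp
      qed
    qed
  qed
  moreover have "z * ?c = ?c * z" if "z * k = k * z" for z
  proof -
    have "z * (1 - k) = (1 - k) * z" using that by (simp add: algebra_simps)
    then have eq: "z * Y n = Y n * z" for n
      unfolding Y_def by (rule sqrt_iter_commute)
    have "tends (\<lambda>n. z * Y n) (z * L)" by (intro tends_mult tends_const L)
    moreover have "tends (\<lambda>n. z * Y n) (L * z)"
      unfolding eq by (intro tends_mult tends_const L)
    ultimately show ?thesis using tends_unique by (simp add: algebra_simps)
  qed
  ultimately show ?thesis by blast
qed

text \<open>With the contraction \<open>f = (1 + h)\<^sup>-\<^sup>1\<close> one has \<open>h = f (1 - f) (1 + h)\<^sup>2\<close>.\<close>

lemma pos_sqrt_exists:
  assumes h: "pos h"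
  shows "\<exists>r. pos r \<and> r * r = h \<and> (\<forall>z. z * h = h * z \<longrightarrow> z * r = r * z)"
proof -
  define f where "f = resolvent h 1"
  have f: "(1 + h) * f = 1" "f * (1 + h) = 1" "star f = f" "pos f"
    and fc: "\<And>z. z * h = h * z \<Longrightarrow> z * f = f * z"
    and pf: "p i f \<le> 1" and phf: "p i (h * f) \<le> 1" for i
    using resolvent[OF h, of 1] resolvent_star[OF h, of 1] pos_resolvent[OF h, of 1]
      resolvent_commute[OF h, of 1] p_emb_resolvent[OF h, of 1 i] p_mult_resolvent[OF h, of 1 i]
    by (simp_all add: f_def emb_1)
  have hf: "1 - f = h * f" using f(1) by (simp add: algebra_simps)
  \<comment> \<open>Both \<open>f\<close> and \<open>1 - f\<close> satisfy the hypotheses of the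
    contractive case and so have square roots \<open>a\<close> and \<open>b\<close>.\<close>
  have "p i (1 - f) \<le> 1" for i by (simp only: hf phf)
  then obtain a where a: "pos a" "a * a = f" and ac: "\<And>z. z * f = f * z \<Longrightarrow> z * a = a * z"
    using contractive_sqrt_exists[OF f(3)] by blast
  have "star (1 - f) = 1 - f" "p i (1 - (1 - f)) \<le> 1" for i
    using pf by (simp_all add: star_simps f(3))
  then obtain b where b: "pos b" "b * b = 1 - f"
    and bc: "\<And>z. z * (1 - f) = (1 - f) * z \<Longrightarrow> z * b = b * z"
    using contractive_sqrt_exists[of "1 - f"] by blast
  have bc: "z * b = b * z" if "z * f = f * z" for z
    using that by (intro bc) (simp add: algebra_simps)
  have ab: "b * a = a * b"
    by (rule ac, rule sym, rule bc) simp
  have ha: "(1 + h) * a = a * (1 + h)" by (rule ac) (simp add: f)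
  have hb: "(1 + h) * b = b * (1 + h)" by (rule bc) (simp add: f)
  have hab: "(1 + h) * (a * b) = a * b * (1 + h)" using ha hb by (metis mult.assoc)
  let ?r = "a * b * (1 + h)"
  have "pos ?r"
    by (intro pos_mult pos_add pos_one h a b ab[symmetric] hab[symmetric])
  moreover have "?r * ?r = h"
  proof -
    have "?r * ?r = (a * b) * (a * b) * ((1 + h) * (1 + h))"
      using hab by (metis mult.assoc)
    also have "(a * b) * (a * b) = (1 - f) * f"
      using ab a b by (metis mult.assoc)
    also have "(1 - f) * f * ((1 + h) * (1 + h)) = (1 - f) * (1 + h)"
      using f(2) by (metis mult.assoc mult.left_neutral)
    also have "\<dots> = h" using f(2) by (simp only: left_diff_distrib) simp
    finally show ?thesis .
  qed
  moreover have "z * ?r = ?r * z" if "z * h = h * z" for z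
  proof -
    have "z * a = a * z" "z * b = b * z"
      by (rule ac bc, rule fc, rule that)+
    moreover have "z * (1 + h) = (1 + h) * z"
      using that by (simp add: algebra_simps)
    ultimately show ?thesis by (metis mult.assoc)
  qed
  ultimately show ?thesis by blast
qed

definition sqrt_el :: "'a \<Rightarrow> 'a" where
  "sqrt_el h = (SOME r. pos r \<and> r * r = h \<and> (\<forall>z. z * h = h * z \<longrightarrow> z * r = r * z))"

lemma pos_sqrt_el: "pos h \<Longrightarrow> pos (sqrt_el h)"
  and sqrt_el_square: "pos h \<Longrightarrow> sqrt_el h * sqrt_el h = h"
  and sqrt_el_commute: "pos h \<Longrightarrow> z * h = h * z \<Longrightarrow> z * sqrt_el h = sqrt_el h * z"
  using someI_ex[OF pos_sqrt_exists] unfolding sqrt_el_def by blast+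

text \<open>Here \<open>r = \<bar>h\<bar>\<close>. For \<open>g = r + h\<close> one has \<open>g\<^sup>2 = 2 r g\<close>, so \<open>r g \<ge> 0\<close> and \<open>(r + \<epsilon>)\<^sup>-\<^sup>1 r g\<close>
  is a positive approximation of \<open>g\<close>.\<close>

lemma pos_abs_add:
  assumes h: "star h = h" and r: "pos r" "r * r = h * h" "r * h = h * r"
  shows "pos (r + h)"
  unfolding pos_def
proof
  fix i
  define g where "g = r + h"
  have sg: "star g = g" by (simp add: g_def star_simps h pos_star r)
  have gr: "g * r = r * g" by (simp add: g_def algebra_simps r)
  have gg: "g * g = 2 * (r * g)" by (simp add: g_def algebra_simps mult_2 r)
  have rg: "pos (r * g)"
    using pos_square[OF sg] unfolding gg mult_2 by (rule pos_half)
  have "sn.qpos i g"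
  proof (rule sn.qpos_closed[OF sg, where C = "sqrt (2 * p i g)"])
    fix e :: real assume "e > 0"
    then have e: "e\<^sup>2 > 0" by simp
    \<comment> \<open>The square of the error will be of order \<open>e\<^sup>2\<close>, so the
      error itself is linear in \<open>e\<close>.\<close>
    define f where "f = resolvent r (e\<^sup>2)"
    have fg: "f * g = g * f"
      unfolding f_def by (rule resolvent_commute[OF r(1) e gr, symmetric])
    have fr: "f * r = r * f"
      unfolding f_def by (rule resolvent_commute[OF r(1) e, symmetric]) simp
    define d where "d = emb (e\<^sup>2) * f"
    have d: "d + r * f = 1"
      unfolding d_def f_def by (rule resolvent_sum[OF r(1) e])
    have sd: "star d = d"
      unfolding d_def f_def by (rule pos_star[OF pos_emb_resolvent[OF r(1) e]])
    have dg: "d * g = g * d"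
      unfolding d_def using fg by (metis emb_commute mult.assoc)
    have "pos (f * (r * g))"
    proof (rule pos_mult)
      show "pos f" unfolding f_def by (rule pos_resolvent[OF r(1) e])
      show "f * (r * g) = r * g * f" using fg fr by (metis mult.assoc)
    qed (rule rg)
    moreover have "p i (f * (r * g) - g) \<le> sqrt (2 * p i g) * e"
    proof -
      have "r * f * g = f * (r * g)" using fr by (metis mult.assoc)
      moreover have "g = d * g + r * f * g" using d by (metis distrib_right mult.left_neutral)
      ultimately have "f * (r * g) - g = - (d * g)" by (metis add_diff_cancel minus_diff_eq add.commute)
      then have "p i (f * (r * g) - g) = p i (d * g)" by (simp add: sn.q_minus)
      moreover have "(p i (d * g))\<^sup>2 \<le> (sqrt (2 * p i g) * e)\<^sup>2"
      proof -
        have "star (d * g) = d * g" by (simp add: star_simps sd sg dg)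
        then have "(p i (d * g))\<^sup>2 = p i ((d * g) * (d * g))" by (simp add: sn.q_square)
        also have "(d * g) * (d * g) = d * d * (g * g)" using dg by (metis mult.assoc)
        \<comment> \<open>One factor \<open>d\<close> is unfolded to
          \<open>emb (e\<^sup>2) * f\<close>; its \<open>f\<close> joins the \<open>r\<close> from
          \<open>g * g = 2 * (r * g)\<close>, leaving the contractions \<open>d\<close> and
          \<open>r * f\<close>.\<close>
        also have "d * d * (g * g) = 2 * (emb (e\<^sup>2) * (d * (r * f) * g))"
        proof -
          have fd: "f * d = d * f"
            unfolding d_def by (metis emb_commute mult.assoc)
          have "d * d * (r * g) = emb (e\<^sup>2) * (f * d * (r * g))"
            by (subst (1) d_def) (simp add: mult.assoc)
          also have "f * d * (r * g) = d * (r * f) * g"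
            unfolding fd fr[symmetric] by (simp add: mult.assoc)
          finally have "d * d * (r * g) = emb (e\<^sup>2) * (d * (r * f) * g)" .
          then show ?thesis unfolding gg by (simp add: mult_2 distrib_left)
        qed
        also have "p i \<dots> = 2 * p i (emb (e\<^sup>2) * (d * (r * f) * g))" by (rule sn.q_two)
        also have "p i (emb (e\<^sup>2) * (d * (r * f) * g)) \<le> e\<^sup>2 * (1 * 1 * p i g)"
          unfolding d_def f_def using sn.q_emb[of i "e\<^sup>2"]
          by (intro sn.q_mult_bound p_mult_resolvent p_emb_resolvent r e) simp_all
        finally show ?thesis
          by (simp add: power_mult_distrib sn.q_nonneg mult_ac)
      qed
      then have "p i (d * g) \<le> sqrt (2 * p i g) * e"
        by (rule power2_le_imp_le) (use \<open>e > 0\<close> sn.q_nonneg in auto)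
      ultimately show ?thesis by simp
    qed
    ultimately show "\<exists>k. sn.qpos i k \<and> p i (k - g) \<le> sqrt (2 * p i g) * e"
      unfolding pos_def by blast
  qed
  then show "sn.qpos i (r + h)" by (simp add: g_def)
qed

section \<open>Absolute values of self-adjoint elements\<close>

definition abs_el :: "'a \<Rightarrow> 'a" where
  "abs_el h = sqrt_el (h * h)"

context
  fixes h assumes h: "star h = h"
begin

lemma pos_abs_el: "pos (abs_el h)"
  unfolding abs_el_def by (intro pos_sqrt_el pos_square h)

lemma abs_el_square: "abs_el h * abs_el h = h * h"
  unfolding abs_el_def by (intro sqrt_el_square pos_square h)

lemma abs_el_commute: "abs_el h * h = h * abs_el h"
  unfolding abs_el_def
  by (rule sqrt_el_commute[symmetric]) (simp_all add: pos_square h mult.assoc)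

lemma pos_abs_el_diff: "pos (abs_el h - h)"
  using pos_abs_add[of "- h" "abs_el h"] h pos_abs_el abs_el_square abs_el_commute
  by (simp add: star_simps)

end

subsection \<open>Positivity of \<open>x\<^sup>* x\<close>\<close>

text \<open>The two products have the same nonzero spectrum: if \<open>w\<close> inverts
  \<open>z - y * star y\<close>, then \<open>(1 + star y * w * y) / z\<close> inverts
  \<open>z - star y * y\<close>.\<close>

lemma positive_el_mult_commute:
  assumes "positive_el smul star (y * star y)"
  shows "positive_el smul star (star y * y)"
proof -
  have "invertible_el (z *\<^sub>C 1 - star y * y)"
    if z: "invertible_el (z *\<^sub>C 1 - y * star y)" "z \<noteq> 0" for z
  proof -
    obtain w where w: "(z *\<^sub>C 1 - y * star y) * w = 1" "w * (z *\<^sub>C 1 - y * star y) = 1"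
      using z(1) unfolding invertible_el_def by blast
    let ?b = "z *\<^sub>C 1 - star y * y" and ?v = "1 + star y * w * y"
    have "?b * star y = star y * (z *\<^sub>C 1 - y * star y)"
      "y * ?b = (z *\<^sub>C 1 - y * star y) * y"
      by (simp_all add: algebra_simps smul_mult_left mult_smul_right)
    then have "?b * (star y * w * y) = star y * y" "star y * w * y * ?b = star y * y"
      using w by (metis mult.assoc mult.left_neutral)+
    then have "?b * ?v = z *\<^sub>C 1" "?v * ?b = z *\<^sub>C 1"
      by (simp_all only: distrib_left distrib_right) simp_all
    then have "?b * ((1 / z) *\<^sub>C ?v) = 1" "((1 / z) *\<^sub>C ?v) * ?b = 1"
      using z(2) by (simp_all only: smul_mult_left mult_smul_right) simp_all
    then show ?thesis unfolding invertible_el_def by blast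
  qed
  then have "alg_spectrum smul (star y * y) \<subseteq> insert 0 (alg_spectrum smul (y * star y))"
    unfolding alg_spectrum_def by blast
  then show ?thesis
    using assms unfolding positive_el_def by (force simp: star_simps)
qed

text \<open>Kaplansky's argument: for \<open>h = x\<^sup>* x\<close>, \<open>g = \<bar>h\<bar> - h\<close> and \<open>y = x g\<close> one has
  \<open>2 y\<^sup>* y = - g\<^sup>3 \<le> 0\<close>; since \<open>y\<^sup>* y + y y\<^sup>* \<ge> 0\<close>, also \<open>y y\<^sup>* \<ge> 0\<close> and hence \<open>y\<^sup>* y \<ge> 0\<close>.\<close>

lemma pos_star_mult: "pos (star x * x)"
proof -
  define h where "h = star x * x"
  have sh: "star h = h" by (simp add: h_def star_simps)
  define r where "r = abs_el h"
  define g where "g = r - h"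
  have r: "pos r" "r * r = h * h" "r * h = h * r" "pos g"
    unfolding g_def r_def using sh by (simp_all add: pos_abs_el abs_el_square abs_el_commute pos_abs_el_diff)
  have sg: "star g = g" using r by (simp add: pos_star)
  define y where "y = x * g"
  have gg: "g * g = - (h * g) - (h * g)" using r by (simp add: g_def algebra_simps)
  have yy: "star y * y = g * (h * g)" by (simp add: y_def h_def star_simps sg mult.assoc)
  have "pos (g * g * g)" by (rule pos_conj_commute) (simp_all add: r sg)
  also have "g * g * g = g * (- (h * g) - (h * g))"
    by (simp only: mult.assoc flip: gg)
  also have "\<dots> = - (star y * y) + - (star y * y)"
    unfolding yy by (simp add: right_diff_distrib)
  finally have neg: "pos (- (star y * y))"
    by (rule pos_half)
  \<comment> \<open>Up to factors 2 and -2 these are the real and imaginary parts of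
    \<open>y\<close>; in the sum of their squares the terms \<open>y * y\<close> and
    \<open>star y * star y\<close> cancel.\<close>
  define a where "a = y + star y"
  define b where "b = \<i> *\<^sub>C (y - star y)"
  have "pos (a * a + b * b)"
    by (intro pos_add pos_square) (simp_all add: a_def b_def star_simps algebra_simps)
  also have "a * a + b * b = 2 * (star y * y + y * star y)"
    by (simp add: a_def b_def algebra_simps smul_mult_left mult_smul_right mult_2)
  finally have "pos (star y * y + y * star y)"
    unfolding mult_2 by (rule pos_half)
  from pos_add[OF this neg] have "pos (y * star y)" by simp
  then have "pos (star y * y)"
    using positive_el_mult_commute by (simp only: positive_el_iff_pos)
  then have "star y * y = 0" using neg pos_antisym by blast
  then have "g * (g * g) = 0" using yy unfolding gg by (simp add: right_diff_distrib)
  \<comment> \<open>The cube is raised to a fourth power so that the C*-identity applies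
    twice.\<close>
  then have "(g * g) * (g * g) = 0" by (metis mult.assoc mult_zero_right)
  moreover have "p i ((g * g) * (g * g)) = ((p i g)\<^sup>2)\<^sup>2" for i
    by (simp add: sn.q_square star_simps sg)
  ultimately have "p i g = 0" for i
    by (metis sn.q_zero zero_eq_power2)
  then have "g = 0" using separating by blast
  then show ?thesis using r by (simp add: g_def h_def)
qed

lemma pos_conj:
  assumes "pos a" shows "pos (star z * a * z)"
proof -
  have "star z * a * z = star (sqrt_el a * z) * (sqrt_el a * z)"
    using sqrt_el_square[OF assms] pos_star[OF pos_sqrt_el[OF assms]]
    by (metis star_mult mult.assoc)
  then show ?thesis using pos_star_mult by simp
qed

lemma p_conj_mono:
  assumes "pos a" "pos (b - a)" shows "p i (star z * a * z) \<le> p i (star z * b * z)"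
  using pos_conj[OF assms(1), of z] pos_conj[OF assms(2), of z]
  by (intro p_mono) (simp_all add: right_diff_distrib left_diff_distrib)

subsection \<open>Decomposition along two closed ideals\<close>

lemma sqrt_inverse_Suc_tendsto: "(\<lambda>n. sqrt (inverse (real (Suc n)))) \<longlonglongrightarrow> 0"
  using tendsto_real_sqrt[OF LIMSEQ_inverse_real_of_nat] by simp

text \<open>With \<open>r\<close> the root and \<open>f n\<close> the resolvents,
  \<open>r * (a * f n)\<close> lies in the ideal and tends to \<open>r\<close>: the square of the
  error \<open>r * d\<close> is \<open>e n\<close> times the contractions \<open>a * f n\<close> and
  \<open>d\<close>.\<close>

lemma sqrt_el_in_ideal:
  assumes S: "star_ideal smul star S" "sn_closed p S" and a: "a \<in> S" "pos a"
  shows "sqrt_el a \<in> S"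
proof -
  define e where "e n = inverse (real (Suc n))" for n
  have e: "e n > 0" for n by (simp add: e_def)
  define r where "r = sqrt_el a"
  have r: "pos r" "r * r = a"
    using a by (simp_all add: r_def pos_sqrt_el sqrt_el_square)
  define f where "f n = resolvent a (e n)" for n
  have X: "r * (a * f n) \<in> S" for n
    using S(1) a(1) unfolding star_ideal_def by blast
  have "tends (\<lambda>n. r * (a * f n)) r"
  proof (rule tendsI)
    show "(\<lambda>n. sqrt (e n)) \<longlonglongrightarrow> 0" unfolding e_def by (rule sqrt_inverse_Suc_tendsto)
    show "p i (r * (a * f n) - r) \<le> sqrt (e n)" for i n
    proof -
      define d where "d = emb (e n) * f n"
      have d: "d + a * f n = 1"
        unfolding d_def f_def by (rule resolvent_sum[OF a(2) e])
      have sd: "star d = d"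
        unfolding d_def f_def by (rule pos_star[OF pos_emb_resolvent[OF a(2) e]])
      have "r * a = a * r" using r(2) by (metis mult.assoc)
      then have "r * f n = f n * r"
        unfolding f_def by (rule resolvent_commute[OF a(2) e])
      then have rd: "r * d = d * r"
        unfolding d_def by (metis emb_commute mult.assoc)
      have eq: "r * (a * f n) - r = - (r * d)"
        using d by (simp add: algebra_simps flip: distrib_left)
      have "star (r * d) = r * d" by (simp add: star_simps sd pos_star[OF r(1)] rd)
      then have "(p i (r * d))\<^sup>2 = p i ((r * d) * (r * d))" by (simp add: sn.q_square)
      also have "(r * d) * (r * d) = a * d * d" using rd r(2) by (metis mult.assoc)
      also have "a * d * d = emb (e n) * (a * f n * d)"
        by (subst (1) d_def) (metis emb_commute mult.assoc)
      also have "p i (emb (e n) * (a * f n * d)) \<le> e n * (1 * 1)"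
        unfolding d_def f_def using sn.q_emb[of i "e n"] e[of n]
        by (intro sn.q_mult_bound p_mult_resolvent p_emb_resolvent a e) simp_all
      finally have "p i (r * d) \<le> sqrt (e n)"
        by (simp add: real_le_rsqrt)
      then show ?thesis unfolding eq sn.q_minus by simp
    qed
  qed
  with S(2) X show ?thesis unfolding r_def[symmetric] by (rule closed_tends)
qed

text \<open>Writing \<open>u = \<surd>x (D\<^sub>m - D\<^sub>n) \<surd>a\<close> with \<open>D\<^sub>n = (y + e\<^sub>n)\<^sup>-\<^sup>1\<^sup>/\<^sup>2\<close>, the inequalities \<open>x \<le> y\<close> and \<open>a \<le> y\<close>
  give \<open>\<parallel>u\<parallel> \<le> \<parallel>y D\<^sub>m - y D\<^sub>n\<parallel>\<close>, which tends to \<open>0\<close> because \<open>t (t + e)\<^sup>-\<^sup>1\<^sup>/\<^sup>2\<close> tends to \<open>\<surd>t\<close> uniformly.\<close>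

lemma p_sqrt_resolvent_diff:
  assumes x: "pos x" "pos (y - x)" and a: "pos a" "pos (y - a)" and e: "e > 0" "e' > 0"
  shows "(p i (sqrt_el x * (sqrt_el (resolvent y e) - sqrt_el (resolvent y e')) * sqrt_el a))\<^sup>2
    \<le> \<bar>e - e'\<bar>"
proof -
  have y: "pos y" using pos_add[OF x] by simp
  define F F' where "F = resolvent y e" and "F' = resolvent y e'"
  have F: "pos F" "pos F'" unfolding F_def F'_def using y e by (simp_all add: pos_resolvent)
  define D D' where "D = sqrt_el F" and "D' = sqrt_el F'"
  have D: "pos D" "pos D'" "D * D = F" "D' * D' = F'"
    unfolding D_def D'_def using F by (simp_all add: pos_sqrt_el sqrt_el_square)
  have Dc: "z * D = D * z" "z * D' = D' * z" if "z * y = y * z" for z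
    using that y e F unfolding D_def D'_def F_def F'_def
    by (simp_all add: sqrt_el_commute resolvent_commute)
  define s r t where "s = sqrt_el x" and "r = sqrt_el a" and "t = sqrt_el y"
  have srt: "star s = s" "star r = r" "star t = t" "s * s = x" "r * r = a" "t * t = y"
    unfolding s_def r_def t_def using x a y by (simp_all add: pos_sqrt_el sqrt_el_square pos_star)
  define d where "d = D - D'"
  have sd: "star d = d" by (simp add: d_def star_simps pos_star D)
  have dc: "z * d = d * z" if "z * y = y * z" for z
    using Dc[OF that] by (simp add: d_def algebra_simps)
  have td: "t * d = d * t" by (rule dc) (metis srt(6) mult.assoc)
  have yd: "y * d = d * y" by (rule dc) simp
  have yD: "y * D = D * y" "y * D' = D' * y" by (rule Dc, simp)+
  have "(p i (s * d * r))\<^sup>2 = p i (star (s * d * r) * (s * d * r))" by (simp add: sn.q_C_star)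
  also have "star (s * d * r) * (s * d * r) = star (d * r) * x * (d * r)"
    by (simp add: star_simps srt sd mult.assoc flip: srt(4))
  also have "p i \<dots> \<le> p i (star (d * r) * y * (d * r))"
    by (intro p_conj_mono x)
  also have "star (d * r) * y * (d * r) = star (t * d * r) * (t * d * r)"
    by (simp add: star_simps srt sd mult.assoc flip: srt(6))
  \<comment> \<open>The C*-identity swaps the two factors, which brings \<open>a\<close> to the
    middle, where \<open>a \<le> y\<close> applies.\<close>
  also have "p i (star (t * d * r) * (t * d * r)) = p i ((t * d * r) * star (t * d * r))"
    by (simp add: sn.q_C_star sn.q_C_star')
  also have "(t * d * r) * star (t * d * r) = star (d * t) * a * (d * t)"
    by (simp add: star_simps srt sd mult.assoc flip: srt(5))
  also have "p i \<dots> \<le> p i (star (d * t) * y * (d * t))"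
    by (intro p_conj_mono a)
  also have "star (d * t) * y * (d * t) = (y * d) * (y * d)"
    unfolding star_mult sd srt using td yd srt(6) by (metis mult.assoc)
  also have "p i ((y * d) * (y * d)) = (p i (y * d))\<^sup>2"
    by (rule sn.q_square) (simp add: star_simps sd pos_star[OF y] yd)
  also have "y * d = y * D - y * D'"
    by (simp add: d_def right_diff_distrib)
  also have "(p i (y * D - y * D'))\<^sup>2 \<le> p i ((y * D) * (y * D) - (y * D') * (y * D'))"
  proof (rule sn.q_diff_le_square_diff)
    have DD: "D * D' = D' * D" by (rule Dc) (simp add: yD)
    show "sn.qpos i (y * D)" "sn.qpos i (y * D')"
      using pos_mult[OF y D(1) yD(1)] pos_mult[OF y D(2) yD(2)] by (simp_all add: pos_def)
    show "y * D * (y * D') = y * D' * (y * D)"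
      using yD DD by (metis mult.assoc)
  qed
  also have "(y * D) * (y * D) - (y * D') * (y * D') = emb (e' - e) * ((y * F) * (y * F'))"
  proof -
    have 1: "(y * D) * (y * D) = y * F * y" "(y * D') * (y * D') = y * F' * y"
      using yD D(3,4) by (metis mult.assoc)+
    \<comment> \<open>The resolvent identity, from inserting both inverses.\<close>
    have "F - F' = F * ((emb e' + y) - (emb e + y)) * F'"
      using resolvent[OF y e(1)] resolvent[OF y e(2)]
      unfolding F_def F'_def right_diff_distrib left_diff_distrib by (simp add: mult.assoc)
    then have "F - F' = emb (e' - e) * (F * F')"
      by (simp add: emb_diff) (metis emb_commute emb_diff mult.assoc)
    then have "y * F * y - y * F' * y = y * (emb (e' - e) * (F * F')) * y"
      by (metis left_diff_distrib right_diff_distrib)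
    also have "\<dots> = emb (e' - e) * (y * F * (F' * y))"
      by (metis emb_commute mult.assoc)
    also have "F' * y = y * F'" using yD D(4) by (metis mult.assoc)
    finally show ?thesis unfolding 1 .
  qed
  also have "p i (emb (e' - e) * ((y * F) * (y * F'))) \<le> \<bar>e' - e\<bar> * (1 * 1)"
    unfolding F_def F'_def by (intro sn.q_mult_bound sn.q_emb p_mult_resolvent y e)
  finally show ?thesis
    by (simp add: abs_minus_commute s_def r_def d_def D_def D'_def F_def F'_def)
qed

text \<open>A noncommutative Riesz decomposition. Ideal membership enters through the factors
  \<open>sqrt_el a\<close> and \<open>sqrt_el b\<close> of the approximants, and closedness carries
  it to the limits.\<close>

lemma pos_decomposition:
  assumes I: "star_ideal smul star I" "sn_closed p I" and J: "star_ideal smul star J" "sn_closed p J"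
    and a: "a \<in> I" "pos a" and b: "b \<in> J" "pos b" and x: "pos x" "pos (a + b - x)"
  obtains c d where "c \<in> I" "pos c" "d \<in> J" "pos d" "x = c + d"
proof -
  define y where "y = a + b"
  have y: "pos y" "pos (y - x)" "pos (y - a)" "pos (y - b)"
    using pos_add a b x by (simp_all add: y_def)
  define e where "e n = inverse (real (Suc n))" for n
  have e: "e n > 0" for n by (simp add: e_def)
  define D where "D n = sqrt_el (resolvent y (e n))" for n
  define s where "s = sqrt_el x"
  have s: "star s = s" "s * s = x" using x by (simp_all add: s_def pos_sqrt_el sqrt_el_square pos_star)
  have D: "star (D n) = D n" "D n * D n = resolvent y (e n)" for n
    unfolding D_def using y(1) e by (simp_all add: pos_sqrt_el sqrt_el_square pos_star pos_resolvent)
  have main: "\<exists>u. u * star u \<in> S \<and>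
      tends (\<lambda>n. s * D n * c * D n * s) (u * star u)"
    if S: "star_ideal smul star S" "sn_closed p S" and c: "c \<in> S" "pos c" "pos (y - c)" for S c
  proof -
    define r where "r = sqrt_el c"
    have r: "r \<in> S" "star r = r" "r * r = c"
      unfolding r_def using S c
      by (simp_all add: sqrt_el_in_ideal pos_sqrt_el sqrt_el_square pos_star)
    define X where "X n = s * D n * r" for n
    have "\<exists>N. \<forall>m\<ge>N. \<forall>n\<ge>N. p i (X m - X n) < \<epsilon>" if "\<epsilon> > 0" for i \<epsilon>
    proof -
      \<comment> \<open>\<open>p_sqrt_resolvent_diff\<close> controls the squared distance by a
        difference of two values in \<open>(0, e N]\<close>.\<close>
      obtain N where N: "e N < \<epsilon>\<^sup>2"
        using reals_Archimedean[of "\<epsilon>\<^sup>2"] \<open>\<epsilon> > 0\<close> by (auto simp: e_def)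
      have "p i (X m - X n) < \<epsilon>" if mn: "m \<ge> N" "n \<ge> N" for m n
      proof -
        have "e m \<le> e N" "e n \<le> e N" using mn by (simp_all add: e_def)
        then have "\<bar>e m - e n\<bar> < \<epsilon>\<^sup>2" using e[of m] e[of n] N by linarith
        moreover have eq: "X m - X n = s * (D m - D n) * r"
          by (simp add: X_def algebra_simps)
        ultimately have "(p i (X m - X n))\<^sup>2 < \<epsilon>\<^sup>2"
          using p_sqrt_resolvent_diff[OF x(1) y(2) c(2,3) e[of m] e[of n], of i]
          unfolding eq s_def r_def D_def by linarith
        then show ?thesis using \<open>\<epsilon> > 0\<close> by (simp add: power2_less_imp_less)
      qed
      then show ?thesis by blast
    qed
    then obtain u where u: "tends X u" using Cauchy_tends by blast
    have "X n \<in> S" for n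
      using S(1) r(1) unfolding X_def star_ideal_def by blast
    then have "u \<in> S" using closed_tends[OF S(2) _ u] by blast
    then have "u * star u \<in> S" using S(1) unfolding star_ideal_def by blast
    moreover have "tends (\<lambda>n. X n * star (X n)) (u * star u)"
      by (intro tends_mult tends_star u)
    moreover have "X n * star (X n) = s * D n * c * D n * s" for n
      by (simp add: X_def star_simps r s D mult.assoc flip: r(3))
    ultimately show ?thesis by auto
  qed
  obtain u where u: "u * star u \<in> I" "tends (\<lambda>n. s * D n * a * D n * s) (u * star u)"
    using main[OF I a y(3)] by blast
  obtain v where v: "v * star v \<in> J" "tends (\<lambda>n. s * D n * b * D n * s) (v * star v)"
    using main[OF J b y(4)] by blast
  have "tends (\<lambda>n. s * D n * a * D n * s + s * D n * b * D n * s) x"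
  proof (rule tendsI)
    show "e \<longlonglongrightarrow> 0" unfolding e_def by (rule LIMSEQ_inverse_real_of_nat)
    show "p i (s * D n * a * D n * s + s * D n * b * D n * s - x) \<le> e n" for i n
    proof -
      let ?F = "resolvent y (e n)"
      have yD: "y * D n = D n * y"
        unfolding D_def
        by (intro sqrt_el_commute resolvent_commute pos_resolvent y e) simp
      have "s * D n * a * D n * s + s * D n * b * D n * s = s * (D n * y * D n) * s"
        by (simp only: y_def distrib_left distrib_right mult.assoc)
      also have "D n * y * D n = y * ?F"
        unfolding yD[symmetric] mult.assoc D(2) ..
      also have "y * ?F = 1 - emb (e n) * ?F"
        using resolvent_sum[OF y(1) e[of n]] by (simp add: eq_diff_eq add.commute)
      also have "s * (1 - emb (e n) * ?F) * s = x - s * (emb (e n) * ?F) * s"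
        using s by (simp add: right_diff_distrib left_diff_distrib)
      also have "s * (emb (e n) * ?F) * s = emb (e n) * ((s * D n) * star (s * D n))"
        by (simp add: star_simps s(1) D(1) mult.assoc emb_left_commute flip: D(2))
      finally have eq: "s * D n * a * D n * s + s * D n * b * D n * s - x
          = - (emb (e n) * ((s * D n) * star (s * D n)))" by simp
      \<comment> \<open>Reversing the factors puts \<open>x\<close> between the \<open>D n\<close>,
        where \<open>x \<le> y\<close> reduces the bound to the contraction
        \<open>y * ?F\<close>.\<close>
      have "p i ((s * D n) * star (s * D n)) = p i (star (s * D n) * (s * D n))"
        by (simp add: sn.q_C_star sn.q_C_star')
      also have "star (s * D n) * (s * D n) = star (D n) * x * D n"
        unfolding star_mult s(1) s(2)[symmetric] by (simp add: mult.assoc)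
      also have "p i \<dots> \<le> p i (star (D n) * y * D n)"
        by (intro p_conj_mono x y)
      also have "star (D n) * y * D n = y * ?F"
        unfolding D(1) yD[symmetric] mult.assoc D(2) ..
      also have "p i (y * ?F) \<le> 1" by (intro p_mult_resolvent y e)
      finally have "p i (emb (e n) * ((s * D n) * star (s * D n))) \<le> e n * 1"
        using sn.q_emb[of i "e n"] e[of n] by (intro sn.q_mult_bound) simp_all
      then show ?thesis unfolding eq sn.q_minus by simp
    qed
  qed
  then have "x = u * star u + v * star v"
    using tends_add[OF u(2) v(2)] tends_unique by blast
  moreover have "pos (u * star u)" "pos (v * star v)"
    using pos_star_mult[of "star u"] pos_star_mult[of "star v"] by (simp_all add: star_star)
  ultimately show thesis using that u(1) v(1) by blast
qed

text \<open>As the sum is self-adjoint, the summands may be replaced by their real parts. The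
  absolute values of these stay in the ideals, being square roots of squares, and their sum
  dominates \<open>a + b\<close>.\<close>

lemma positive_part_ideal_sum:
  assumes I: "star_ideal smul star I" "sn_closed p I" and J: "star_ideal smul star J" "sn_closed p J"
    and a: "a \<in> I" and b: "b \<in> J" and x: "pos (a + b)"
  obtains c d where "c \<in> I" "pos c" "d \<in> J" "pos d" "a + b = c + d"
proof -
  define re where "re z = (1/2) *\<^sub>C (z + star z)" for z
  have re_star: "star (re z) = re z" for z by (simp add: re_def star_simps add.commute)
  have re_mem: "re z \<in> S" if "star_ideal smul star S" "z \<in> S" for z S
    using that unfolding re_def star_ideal_def by blast
  have "re a + re b = re (a + b)"
    by (simp add: re_def star_simps vs.scale_right_distrib)
  also have "\<dots> = a + b"
    using two_half[of "a + b"] by (simp add: re_def pos_star[OF x] vs.scale_right_distrib)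
  finally have ab: "re a + re b = a + b" .
  have abs: "abs_el (re z) \<in> S" if "star_ideal smul star S" "sn_closed p S" "z \<in> S" for z S
    unfolding abs_el_def
    using that re_mem[OF that(1,3)]
    by (intro sqrt_el_in_ideal pos_square re_star) (auto simp: star_ideal_def)
  have "pos (abs_el (re a) - re a + (abs_el (re b) - re b))"
    by (intro pos_add pos_abs_el_diff re_star)
  also have "\<dots> = abs_el (re a) + abs_el (re b) - (a + b)"
    by (simp flip: ab)
  finally show thesis
    using that
    by (rule pos_decomposition[OF I J abs[OF I a] pos_abs_el[OF re_star]
          abs[OF J b] pos_abs_el[OF re_star] x])
qed

end

theorem theorem3:
  fixes smul :: "complex \<Rightarrow> 'a::ring_1 \<Rightarrow> 'a"
    and star :: "'a \<Rightarrow> 'a"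
    and p :: "'i \<Rightarrow> 'a \<Rightarrow> real"
    and I J :: "'a set"
  assumes "locally_C_star_algebra smul star p"
    and "star_ideal smul star I" and "sn_closed p I"
    and "star_ideal smul star J" and "sn_closed p J"
  shows "{x \<in> {a + b | a b. a \<in> I \<and> b \<in> J}. positive_el smul star x}
       = {a + b | a b. a \<in> I \<and> positive_el smul star a \<and> b \<in> J \<and> positive_el smul star b}"
proof -
  interpret locally_C_star smul star p
    using assms(1) by unfold_locales (simp_all add: locally_C_star_algebra_def)
  \<comment> \<open>The inclusion from left to right; the other one is closure of the positive cone
    and the definition of \<open>I + J\<close>.\<close>
  have "\<exists>c d. a + b = c + d \<and> c \<in> I \<and> pos c \<and> d \<in> J \<and> pos d"
    if "a \<in> I" "b \<in> J" "pos (a + b)" for a b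
    using positive_part_ideal_sum[OF assms(2-5) that] by metis
  then show ?thesis
    unfolding positive_el_iff_pos using pos_add by fast
qed

end
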